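(* Let $n\geqslant 2$ be an integer and $p\geqslant 1$ a real number. There exists a constant $C=C(n,p)>1$, depending only on $n$ and $p$, such that every nonnegative $u\in C^2(\mathbb R^n)$ with $|\nabla u(x)|<1$ for all $x\in\mathbb R^n$ and $$\operatorname{div}\left(\frac{\nabla u}{\sqrt{1-|\nabla u|^2}}\right)+u^p=0\qquad\text{in }\mathbb R^n$$ satisfies $$\sup_{\mathbb R^n}u\leqslant C,\qquad \sup_{\mathbb R^n}\frac{1}{\sqrt{1-|\nabla u|^2}}\leqslant C.$$ In particular, $|\nabla u|\leqslant\sqrt{1-C^{-2}}<1$ throughout $\mathbb R^n$.
   Context: $|\cdot|$, $\nabla$ and $\operatorname{div}$ are the Euclidean norm, gradient and divergence on $\mathbb R^n$. The equation is understood pointwise (classically). *)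

theory Defs
  imports "HOL-Analysis.Analysis"
begin

definition partial :: "'n::finite \<Rightarrow> (real ^ 'n \<Rightarrow> real) \<Rightarrow> real ^ 'n \<Rightarrow> real" where
  "partial i f x = deriv (\<lambda>t. f (x + t *\<^sub>R axis i 1)) 0"

definition grad :: "(real ^ 'n \<Rightarrow> real) \<Rightarrow> real ^ 'n \<Rightarrow> real ^ 'n::finite" where
  "grad u x = (\<chi> i. partial i u x)"

definition divergence :: "(real ^ 'n \<Rightarrow> real ^ 'n) \<Rightarrow> real ^ 'n::finite \<Rightarrow> real" where
  "divergence F x = (\<Sum>i\<in>UNIV. partial i (\<lambda>y. F y $ i) x)"

text \<open>
  \<open>C\<^sup>2\<close> on the whole space, in the sense of Frechet derivatives: \<open>g\<close> is the gradient and the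
  matrix field \<open>H\<close> is the Hessian. For such a function the partial derivatives used in
  \<^const>\<open>grad\<close> exist, so \<open>g\<close> coincides with \<^term>\<open>grad u\<close>.
\<close>
definition C2 :: "(real ^ 'n::finite \<Rightarrow> real) \<Rightarrow> bool" where
  "C2 u \<longleftrightarrow> (\<exists>(g :: real ^ 'n \<Rightarrow> real ^ 'n) (H :: real ^ 'n \<Rightarrow> real ^ 'n ^ 'n).
     (\<forall>x. GDERIV u x :> g x) \<and>
     (\<forall>x. (g has_derivative (\<lambda>h. H x *v h)) (at x)) \<and>
     continuous_on UNIV H)"

end

theory Submission imports Defs begin

text \<open>
  The operator is the mean curvature operator of spacelike graphs in Minkowski space, and both
  bounds come from comparison arguments that rest on the second derivative test for \<open>C\<^sup>2\<close> functions.

  \<^emph>\<open>Height.\<close> A spacelike function is 1-Lipschitz. So if \<open>u\<close> has a large value \<open>M\<close> at \<open>x0\<close>, it is at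
  least \<open>M / 2\<close> on the ball of radius \<open>M / 2\<close> around \<open>x0\<close>, where the equation prescribes a curvature of
  at least \<open>(M / 2) powr p\<close>. This much curvature bends a radial graph almost to a light cone, and
  outside the ball the flux \<open>\<nabla>w / sqrt (1 - \<bar>\<nabla>w\<bar>\<^sup>2)\<close> needs to decay only by a bounded factor up to
  distance \<open>2 M\<close>: there is a radial subsolution \<open>w\<close> whose slope is nearly \<open>- 1\<close> from close to the
  centre up to distance \<open>2 M\<close>. It loses more than \<open>M\<close> on the way, and by comparison so does \<open>u\<close>
  towards some point of the sphere of radius \<open>2 M\<close>, where it is then negative. This is
  \<open>height_bound\<close>.

  \<^emph>\<open>Gradient.\<close> Differentiating the equation would require three derivatives. Instead the maximum
  principle is applied to the function \<open>u x - u y - \<phi> \<bar>x - y\<bar>\<close> of two points, with \<open>\<phi>\<close> an arc of a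
  hyperbola. At a maximum both gradients equal \<open>\<phi>' e\<close>, where \<open>e\<close> is the unit vector along \<open>x - y\<close>.
  Moving \<open>x\<close> and \<open>y\<close> in directions that are mirror images of each other in the hyperplane
  orthogonal to \<open>e\<close> shows that the curvatures of \<open>u\<close> at \<open>x\<close> and \<open>y\<close> differ by at least four times the curvature of the
  hyperbola. Since \<open>u\<close> is bounded, so is \<open>u powr p\<close>, and a hyperbola that is curved enough excludes
  such a maximum; it may also be taken long enough to reach the bound of \<open>u\<close> at its far end. Hence
  \<open>u x - u y \<le> \<phi> \<bar>x - y\<bar>\<close>, and the slope of \<open>\<phi>\<close> at \<open>0\<close>, which is less than \<open>1\<close>, bounds the gradient. The
  maximum need not be attained on the whole space, so a penalty \<open>\<epsilon> \<bar>x\<bar>\<^sup>2\<close> is subtracted; it disturbs the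
  coefficients of the operator, and the exact form of the resulting inequality
  (\<open>two_point_inequality\<close>) allows the limit \<open>\<epsilon> \<rightarrow> 0\<close> although the Hessian of \<open>u\<close> may be unbounded
  (\<open>concavity_excludes_limit\<close>).
\<close>

section \<open>Second derivatives along lines\<close>

lemma second_derivative_test:
  fixes f f1 :: "real \<Rightarrow> real"
  assumes f: "\<forall>\<^sub>F t in nhds 0. (f has_real_derivative f1 t) (at t)"
    and f1: "(f1 has_real_derivative D) (at 0)"
    and max: "\<forall>\<^sub>F t in nhds 0. f t \<le> f 0"
  shows "f1 0 = 0" and "D \<le> 0"
proof -
  obtain d where d: "d > 0" "\<And>t. \<bar>t\<bar> < d \<Longrightarrow> (f has_real_derivative f1 t) (at t)"
    "\<And>t. \<bar>t\<bar> < d \<Longrightarrow> f t \<le> f 0"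
    using eventually_conj[OF f max] unfolding eventually_nhds_metric dist_real_def by auto
  show z: "f1 0 = 0"
    using DERIV_local_max[of f "f1 0" 0 d] d by auto
  show "D \<le> 0"
  proof (rule ccontr)
    assume "\<not> D \<le> 0"
    then obtain e where e: "e > 0" "\<And>h. 0 < h \<Longrightarrow> h < e \<Longrightarrow> f1 0 < f1 (0 + h)"
      using DERIV_pos_inc_right[OF f1] by auto
    define r where "r = min d e / 2"
    have r: "0 < r" "r < d" "r < e" using d e by (auto simp: r_def)
    have "f 0 < f r"
    proof (rule DERIV_pos_imp_increasing_open[OF r(1)])
      fix t assume "0 < t" "t < r"
      then show "\<exists>y. (f has_real_derivative y) (at t) \<and> y > 0"
        using d(2)[of t] e(2)[of t] z r by auto
    next
      show "continuous_on {0..r} f"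
        by (intro continuous_at_imp_continuous_on ballI DERIV_isCont[OF d(2)]) (use r in auto)
    qed
    with d(3)[of r] r show False by auto
  qed
qed

text \<open>
  The vectors \<open>e\<^sub>i + k a\<^sub>i a\<close> are the columns of \<open>S = I + k (a \<otimes> a)\<close>, and summing \<open>B\<close> over them
  gives the trace of \<open>B\<close> against \<open>S\<^sup>2 = I + (2 k + k\<^sup>2 \<bar>a\<bar>\<^sup>2) (a \<otimes> a)\<close>. Thus a contraction of the
  Hessian with a variable coefficient matrix becomes a sum of second derivatives along lines.
\<close>
lemma sum_rank_one_frame:
  fixes a :: "real ^ 'n::finite" and B :: "real ^ 'n \<Rightarrow> real ^ 'n \<Rightarrow> real"
  assumes "bilinear B"
  shows "(\<Sum>i\<in>UNIV. B (axis i 1 + (k * a $ i) *\<^sub>R a) (axis i 1 + (k * a $ i) *\<^sub>R a))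
    = (\<Sum>i\<in>UNIV. B (axis i 1) (axis i 1)) + (2 * k + k\<^sup>2 * (norm a)\<^sup>2) * B a a"
proof -
  have ea: "(\<Sum>i\<in>UNIV. a $ i *\<^sub>R axis i 1) = a"
    using basis_expansion[of a] by (simp add: scalar_mult_eq_scaleR)
  have lin: "linear (\<lambda>x. B x a)" "linear (B a)"
    using assms by (auto simp: bilinear_def)
  have l: "(\<Sum>i\<in>UNIV. a $ i * B (axis i 1) a) = B a a"
    using arg_cong[OF ea, of "\<lambda>x. B x a"] by (simp add: linear_sum[OF lin(1)] linear_scale[OF lin(1)])
  have r: "(\<Sum>i\<in>UNIV. a $ i * B a (axis i 1)) = B a a"
    using arg_cong[OF ea, of "B a"] by (simp add: linear_sum[OF lin(2)] linear_scale[OF lin(2)])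
  have n: "(\<Sum>i\<in>UNIV. (a $ i)\<^sup>2) = (norm a)\<^sup>2"
    unfolding power2_norm_eq_inner inner_vec_def by (simp add: power2_eq_square)
  have "B (axis i 1 + (k * a $ i) *\<^sub>R a) (axis i 1 + (k * a $ i) *\<^sub>R a)
     = B (axis i 1) (axis i 1) + k * (a $ i * B (axis i 1) a) + k * (a $ i * B a (axis i 1))
       + (k\<^sup>2 * B a a) * (a $ i)\<^sup>2" for i
    using assms by (simp add: bilinear_ladd bilinear_radd bilinear_lmul bilinear_rmul
        algebra_simps power2_eq_square)
  then show ?thesis
    by (simp add: sum.distrib sum_distrib_left[symmetric] l r n) (simp add: algebra_simps)
qed

lemma gradient_along_line:
  assumes "GDERIV u (x + t *\<^sub>R \<xi>) :> G"
  shows "((\<lambda>t. u (x + t *\<^sub>R \<xi>)) has_real_derivative (G \<bullet> \<xi>)) (at t)"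
proof -
  have "((\<lambda>t. x + t *\<^sub>R \<xi>) has_derivative (\<lambda>s. s *\<^sub>R \<xi>)) (at t)"
    by (auto intro!: derivative_eq_intros)
  from has_derivative_compose[OF this assms[unfolded gderiv_def]]
  show ?thesis
    unfolding has_field_derivative_def by (rule has_derivative_eq_rhs) (auto simp: inner_commute)
qed

lemma hessian_along_line:
  fixes g :: "real ^ 'n::finite \<Rightarrow> real ^ 'n"
  assumes "(g has_derivative (\<lambda>h. H *v h)) (at (x + t *\<^sub>R \<xi>))"
  shows "((\<lambda>t. g (x + t *\<^sub>R \<xi>) \<bullet> \<eta>) has_real_derivative ((H *v \<xi>) \<bullet> \<eta>)) (at t)"
proof -
  have "((\<lambda>t. x + t *\<^sub>R \<xi>) has_derivative (\<lambda>s. s *\<^sub>R \<xi>)) (at t)"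
    by (auto intro!: derivative_eq_intros)
  from has_derivative_compose[OF this assms]
  have "((\<lambda>t. g (x + t *\<^sub>R \<xi>)) has_derivative (\<lambda>s. H *v (s *\<^sub>R \<xi>))) (at t)" .
  then show ?thesis
    unfolding has_field_derivative_def
    by (auto intro!: derivative_eq_intros simp: matrix_vector_mult_scaleR)
qed

lemma divergence_expanded:
  fixes g :: "real ^ 'n::finite \<Rightarrow> real ^ 'n"
  assumes g: "(g has_derivative (\<lambda>h. H *v h)) (at x)" and lt: "norm (g x) < 1"
  shows "divergence (\<lambda>y. (1 / sqrt (1 - (norm (g y))\<^sup>2)) *\<^sub>R g y) x
    = ((\<Sum>i\<in>UNIV. (H *v axis i 1) \<bullet> axis i 1) + ((H *v g x) \<bullet> g x) / (1 - (norm (g x))\<^sup>2))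
      / sqrt (1 - (norm (g x))\<^sup>2)"
proof -
  define w where "w = sqrt (1 - (norm (g x))\<^sup>2)"
  have pos: "1 - (norm (g x))\<^sup>2 > 0" using lt by (simp add: power_less_one_iff abs_square_less_1)
  have w: "w > 0" "w\<^sup>2 = 1 - (norm (g x))\<^sup>2" using pos by (auto simp: w_def)
  have part: "partial i (\<lambda>y. ((1 / sqrt (1 - (norm (g y))\<^sup>2)) *\<^sub>R g y) $ i) x
    = ((H *v axis i 1) \<bullet> axis i 1) / w + (g x $ i *\<^sub>R (H *v axis i 1)) \<bullet> g x / w ^ 3" for i
  proof -
    define \<gamma> where "\<gamma> t = g (x + t *\<^sub>R axis i 1)" for t :: real
    have "((\<lambda>t. x + t *\<^sub>R axis i 1) has_derivative (\<lambda>s. s *\<^sub>R axis i 1)) (at (0::real))"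
      by (auto intro!: derivative_eq_intros)
    from has_derivative_compose[OF this, of g "\<lambda>h. H *v h"] g
    have \<gamma>: "(\<gamma> has_derivative (\<lambda>s. s *\<^sub>R (H *v axis i 1))) (at 0)"
      by (simp add: \<gamma>_def[abs_def] matrix_vector_mult_scaleR)
    have \<gamma>0: "\<gamma> 0 = g x" by (simp add: \<gamma>_def)
    have n: "((\<lambda>t. 1 - \<gamma> t \<bullet> \<gamma> t) has_real_derivative - (2 * ((H *v axis i 1) \<bullet> g x))) (at 0)"
      unfolding has_field_derivative_def
      by (auto intro!: derivative_eq_intros \<gamma> simp: \<gamma>0 inner_commute)
    have c: "((\<lambda>t. \<gamma> t \<bullet> axis i 1) has_real_derivative ((H *v axis i 1) \<bullet> axis i 1)) (at 0)"
      unfolding has_field_derivative_def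
      by (auto intro!: derivative_eq_intros \<gamma>)
    have w2: "sqrt (1 - g x \<bullet> g x) = w" by (simp add: w_def power2_norm_eq_inner)
    have p2: "1 - g x \<bullet> g x > 0" using pos by (simp add: power2_norm_eq_inner)
    have "((\<lambda>t. (\<gamma> t \<bullet> axis i 1) / sqrt (1 - \<gamma> t \<bullet> \<gamma> t)) has_real_derivative
       ((H *v axis i 1) \<bullet> axis i 1) / w + (g x $ i *\<^sub>R (H *v axis i 1)) \<bullet> g x / w ^ 3) (at 0)"
    proof -
      have s: "((\<lambda>t. sqrt (1 - \<gamma> t \<bullet> \<gamma> t)) has_real_derivative
          (inverse w / 2) * - (2 * ((H *v axis i 1) \<bullet> g x))) (at 0)"
        using DERIV_chain2[OF DERIV_real_sqrt n] p2 by (simp add: \<gamma>0 w2)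
      show ?thesis
        by (rule DERIV_cong[OF DERIV_divide[OF c s]])
          (use w(1) in \<open>simp_all add: \<gamma>0 w2 field_simps inner_axis power2_eq_square power3_eq_cube\<close>)
    qed
    moreover have "(\<lambda>t. ((1 / sqrt (1 - (norm (g (x + t *\<^sub>R axis i 1)))\<^sup>2)) *\<^sub>R g (x + t *\<^sub>R axis i 1)) $ i)
      = (\<lambda>t. (\<gamma> t \<bullet> axis i 1) / sqrt (1 - \<gamma> t \<bullet> \<gamma> t))"
      by (simp add: \<gamma>_def power2_norm_eq_inner inner_axis)
    ultimately show ?thesis
      unfolding partial_def by (simp add: DERIV_imp_deriv)
  qed
  have ea: "(\<Sum>i\<in>UNIV. g x $ i *\<^sub>R (H *v axis i 1)) = H *v g x"
    using arg_cong[OF basis_expansion[of "g x"], of "\<lambda>v. H *v v"]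
    by (simp add: linear_sum[OF matrix_vector_mul_linear] scalar_mult_eq_scaleR matrix_vector_mult_scaleR)
  have "(\<Sum>i\<in>UNIV. (g x $ i *\<^sub>R (H *v axis i 1)) \<bullet> g x / w ^ 3) = ((H *v g x) \<bullet> g x) / w ^ 3"
    by (simp only: sum_divide_distrib[symmetric] inner_sum_left[symmetric] ea)
  then show ?thesis
    unfolding divergence_def part sum.distrib w(2)[symmetric]
    using w(1) by (simp add: sum_divide_distrib[symmetric]
        add_divide_distrib power3_eq_cube power2_eq_square mult.assoc)
qed


lemma sum_inner_axis_squared:
  fixes a :: "real ^ 'n::finite"
  shows "(\<Sum>i\<in>UNIV. (a \<bullet> axis i 1)\<^sup>2) = (norm a)\<^sup>2"
  unfolding power2_norm_eq_inner inner_vec_def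
  by (simp add: power2_eq_square axis_def if_distrib cong: if_cong)

lemma bilinear_inner: "bilinear (\<lambda>x y :: 'a::euclidean_space. x \<bullet> y)"
  by (simp add: bilinear_conv_bounded_bilinear bounded_bilinear_inner)

text \<open>
  The number \<open>k\<close> for which \<open>I + k (p \<otimes> p)\<close> is the positive square root of
  \<open>I + (p \<otimes> p) / (1 - \<bar>p\<bar>\<^sup>2)\<close>, as a function of \<open>P = \<bar>p\<bar>\<^sup>2\<close>. With \<open>w = sqrt (1 - P)\<close> it equals
  \<open>(1 / w - 1) / P\<close>; the form below has no singularity at \<open>P = 0\<close>.
\<close>
definition stretch :: "real \<Rightarrow> real" where
  "stretch P = 1 / (sqrt (1 - P) * (1 + sqrt (1 - P)))"

lemma stretch_equation:
  assumes "P < 1"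
  shows "2 * stretch P + (stretch P)\<^sup>2 * P = 1 / (1 - P)"
proof -
  define w where "w = sqrt (1 - P)"
  have w: "w > 0" "P = 1 - w\<^sup>2" using assms by (auto simp: w_def)
  have "stretch P = 1 / (w * (1 + w))" by (simp add: stretch_def w_def)
  moreover have "2 * (1 / (w * (1 + w))) + (1 / (w * (1 + w)))\<^sup>2 * (1 - w\<^sup>2) = 1 / w\<^sup>2"
  proof -
    define z where "z = 1 + w"
    have z: "z \<noteq> 0" "w = z - 1" "w \<noteq> 0" using w(1) by (auto simp: z_def)
    have "2 * (1 / (w * z)) + (1 / (w * z))\<^sup>2 * ((1 - w) * z) = (2 * w + (1 - w)) / (w\<^sup>2 * z)"
      using z(1,3) by (simp add: field_simps power2_eq_square)
    also have "2 * w + (1 - w) = z" by (simp add: z_def)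
    also have "z / (w\<^sup>2 * z) = 1 / w\<^sup>2" using z(1) by simp
    also have "(1 - w) * z = 1 - w\<^sup>2" by (simp add: z_def algebra_simps power2_eq_square)
    finally show ?thesis by (simp add: z_def)
  qed
  ultimately show ?thesis by (simp add: w(2))
qed

section \<open>The equation in nondivergence form\<close>

text \<open>
  With \<open>w = sqrt (1 - \<bar>g\<bar>\<^sup>2)\<close> the divergence is \<open>(trace H + (H g \<bullet> g) / w\<^sup>2) / w\<close>, and the equation is
  used after multiplication by \<open>w\<close>. The factor \<open>w\<close> this leaves on the right-hand side is
  essential for the gradient estimate.
\<close>
locale entire_solution =
  fixes u :: "real ^ 'n::finite \<Rightarrow> real" and g :: "real ^ 'n \<Rightarrow> real ^ 'n"
    and H :: "real ^ 'n \<Rightarrow> real ^ 'n ^ 'n" and p :: real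
  assumes gradient: "GDERIV u x :> g x"
    and hessian: "(g has_derivative (\<lambda>h. H x *v h)) (at x)"
    and nonneg: "0 \<le> u x"
    and spacelike: "norm (g x) < 1"
    and equation: "(\<Sum>i\<in>UNIV. (H x *v axis i 1) \<bullet> axis i 1)
      + ((H x *v g x) \<bullet> g x) / (1 - (norm (g x))\<^sup>2)
      = - (u x powr p) * sqrt (1 - (norm (g x))\<^sup>2)"
begin

lemma norm_gradient_squared_less_1: "(norm (g x))\<^sup>2 < 1"
  using spacelike[of x] by (simp add: power_less_one_iff abs_square_less_1)

lemma continuous_u: "continuous_on S u"
  using gradient unfolding gderiv_def
  by (intro continuous_at_imp_continuous_on ballI) (metis has_derivative_continuous)

lemma lipschitz: "u x - u y \<le> norm (x - y)"
proof -
  have "onorm (\<lambda>h. h \<bullet> g z) \<le> 1" for z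
  proof (rule onorm_le)
    fix h :: "real ^ 'n"
    have "\<bar>h \<bullet> g z\<bar> \<le> norm h * norm (g z)" by (rule Cauchy_Schwarz_ineq2)
    also have "\<dots> \<le> norm h * 1" using spacelike[of z] by (intro mult_left_mono) auto
    finally show "norm (h \<bullet> g z) \<le> 1 * norm h" by simp
  qed
  then have "norm (u x - u y) \<le> 1 * norm (x - y)"
    using gradient unfolding gderiv_def by (intro differentiable_bound[of UNIV]) auto
  then show ?thesis by simp
qed

lemma bilinear_hessian: "bilinear (\<lambda>\<xi> \<eta>. (H x *v \<xi>) \<bullet> \<eta>)"
  unfolding bilinear_def
  by (auto intro!: linearI simp: matrix_vector_right_distrib matrix_vector_mult_scaleR
      inner_add_left inner_add_right)

text \<open>
  The left-hand side of the equation is the trace of the Hessian against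
  \<open>I + (g \<otimes> g) / (1 - \<bar>g\<bar>\<^sup>2)\<close>, the square of the matrix whose columns are summed over here.
\<close>
lemma equation_in_stretched_frame:
  fixes x
  defines "k \<equiv> stretch ((norm (g x))\<^sup>2)"
  shows "(\<Sum>i\<in>UNIV. (H x *v (axis i 1 + (k * g x $ i) *\<^sub>R g x)) \<bullet> (axis i 1 + (k * g x $ i) *\<^sub>R g x))
    = - (u x powr p) * sqrt (1 - (norm (g x))\<^sup>2)"
  unfolding sum_rank_one_frame[OF bilinear_hessian] k_def stretch_equation[OF norm_gradient_squared_less_1]
  using equation[of x] by simp

end

section \<open>The height estimate\<close>

text \<open>
  The barrier is \<open>G (\<bar>x - x0\<bar>\<^sup>2)\<close>. For a profile with \<open>G' (s) = - 1 / (2 sqrt (s + q s))\<close> the flux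
  \<open>\<nabla>w / sqrt (1 - \<bar>\<nabla>w\<bar>\<^sup>2)\<close> of the barrier \<open>w\<close> is \<open>- (x - x0) / sqrt (q s)\<close> at \<open>s = \<bar>x - x0\<bar>\<^sup>2\<close>.
  The choice of \<open>q\<close> below makes the flux Gaussian, \<open>- c exp (- l s) (x - x0)\<close>. The argument of
  the square root stays positive slightly to the left of \<open>0\<close>, so that \<open>G\<close> has a two-sided
  derivative at \<open>0\<close>.
\<close>
lemma radial_profile_exists:
  fixes l c T :: real
  assumes "c > 0" "l \<ge> 0"
  obtains G where "\<And>s. 0 \<le> s \<Longrightarrow> s \<le> T \<Longrightarrow>
    \<forall>\<^sub>F r in nhds s. (G has_real_derivative - 1 / (2 * sqrt (r + exp (2 * l * r) / c\<^sup>2))) (at r)"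
proof -
  define \<delta> where "\<delta> = 1 / (2 * (c\<^sup>2 + 2 * l))"
  have cl: "c\<^sup>2 + 2 * l > 0" using assms by (simp add: add_pos_nonneg)
  have \<delta>: "\<delta> > 0" "\<delta> * (c\<^sup>2 + 2 * l) = 1 / 2" using cl by (auto simp: \<delta>_def)
  define f where "f r = - 1 / (2 * sqrt (r + exp (2 * l * r) / c\<^sup>2))" for r
  have pos: "r + exp (2 * l * r) / c\<^sup>2 > 0" if "- \<delta> \<le> r" for r
  proof -
    have "- \<delta> * (c\<^sup>2 + 2 * l) \<le> r * (c\<^sup>2 + 2 * l)"
      using that cl by (intro mult_right_mono) auto
    then have "0 < r * c\<^sup>2 + (1 + 2 * l * r)" using \<delta>(2) by (simp add: algebra_simps)
    also have "\<dots> \<le> r * c\<^sup>2 + exp (2 * l * r)" using exp_ge_add_one_self[of "2 * l * r"] by simp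
    finally show ?thesis using assms(1) by (simp add: field_simps)
  qed
  have cont: "continuous_on {- \<delta>..T + 1} f"
    unfolding f_def using pos by (intro continuous_intros) (force simp: assms(1) less_imp_neq[symmetric])+
  define G where "G x = integral {- \<delta>..x} f" for x
  show ?thesis
  proof (rule that)
    fix s :: real assume s: "0 \<le> s" "s \<le> T"
    have "\<forall>\<^sub>F r in nhds s. r \<in> {- \<delta><..<T + 1}"
      using s \<delta>(1) by (intro eventually_nhds_in_open) auto
    then show "\<forall>\<^sub>F r in nhds s. (G has_real_derivative - 1 / (2 * sqrt (r + exp (2 * l * r) / c\<^sup>2))) (at r)"
    proof eventually_elim
      case (elim r)
      with integral_has_real_derivative[OF cont, of r]
      have "(G has_real_derivative f r) (at r)"
        unfolding G_def[abs_def] by (auto simp: at_within_Icc_at)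
      then show ?case by (simp add: f_def)
    qed
  qed
qed

text \<open>
  For \<open>q\<close> constantly equal to \<open>b\<^sup>2\<close> the graph of the barrier is a hyperboloid, and this would be
  an equality; a smaller \<open>q\<close> makes the barrier steeper.
\<close>
lemma radial_profile_drop:
  fixes G q :: "real \<Rightarrow> real"
  assumes G: "\<And>s. 0 \<le> s \<Longrightarrow> s \<le> T \<Longrightarrow> (G has_real_derivative - 1 / (2 * sqrt (s + q s))) (at s)"
    and q: "\<And>s. 0 \<le> s \<Longrightarrow> s \<le> T \<Longrightarrow> 0 < q s \<and> q s \<le> b\<^sup>2"
    and "b > 0" "T \<ge> 0"
  shows "G 0 - G T \<ge> sqrt (T + b\<^sup>2) - b"
proof -
  have "G T + sqrt (T + b\<^sup>2) \<le> G 0 + sqrt (0 + b\<^sup>2)"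
  proof (rule DERIV_nonpos_imp_nonincreasing[OF \<open>T \<ge> 0\<close>])
    fix s assume s: "0 \<le> s" "s \<le> T"
    have sb: "s + b\<^sup>2 > 0" using s \<open>b > 0\<close> by (simp add: add_nonneg_pos)
    have "((\<lambda>s. s + b\<^sup>2) has_real_derivative 1) (at s)" by (auto intro!: derivative_eq_intros)
    from DERIV_add[OF G[OF s] DERIV_chain2[OF DERIV_real_sqrt[OF sb] this]]
    have "((\<lambda>s. G s + sqrt (s + b\<^sup>2)) has_real_derivative
        - 1 / (2 * sqrt (s + q s)) + 1 / (2 * sqrt (s + b\<^sup>2))) (at s)"
      by (simp add: field_simps)
    moreover have "1 / (2 * sqrt (s + b\<^sup>2)) \<le> 1 / (2 * sqrt (s + q s))"
      using q[OF s] s by (intro divide_left_mono mult_pos_pos) (auto simp: add_nonneg_pos sb)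
    ultimately show "\<exists>y. ((\<lambda>s. G s + sqrt (s + b\<^sup>2)) has_real_derivative y) (at s) \<and> y \<le> 0"
      by fastforce
  qed
  then show ?thesis using \<open>b > 0\<close> by simp
qed

context entire_solution
begin

text \<open>
  At a local maximum of \<open>w - u\<close> the gradients of \<open>w\<close> and \<open>u\<close> agree, hence so do the coefficient
  matrices, and the Hessian of \<open>w\<close> lies below that of \<open>u\<close>. The difference
  \<open>CARD('n) - s * q' / q s\<close> is what remains of minus the divergence of the flux of \<open>w\<close> after
  division by the positive factor \<open>1 / sqrt (q s)\<close>.
\<close>
lemma contact_with_radial_barrier:
  assumes G: "\<forall>\<^sub>F r in nhds s. (G has_real_derivative - 1 / (2 * sqrt (r + q r))) (at r)"
    and q: "(q has_real_derivative q') (at s)" "q s > 0"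
    and s: "s = (norm (z - x0))\<^sup>2"
    and max: "\<forall>\<^sub>F y in nhds z. G ((norm (y - x0))\<^sup>2) - u y \<le> G s - u z"
  shows "u z powr p * sqrt (q s) \<le> real CARD('n) - s * q' / q s"
proof -
  define d where "d = z - x0"
  define h where "h = 1 / sqrt (s + q s)"
  have s0: "s \<ge> 0" and sd: "s = d \<bullet> d" by (auto simp: s d_def power2_norm_eq_inner)
  have sq: "s + q s > 0" using s0 q(2) by simp
  have h0: "h > 0" and h2: "h\<^sup>2 * (s + q s) = 1" using sq by (auto simp: h_def power_divide)
  \<comment> \<open>First and second order conditions for \<open>w - u\<close> along the line through \<open>z\<close> in direction \<open>\<xi>\<close>.\<close>
  have along: "- (h * (d \<bullet> \<xi>)) - g z \<bullet> \<xi> = 0"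
      "(1 + q') * h ^ 3 * (d \<bullet> \<xi>)\<^sup>2 - h * (\<xi> \<bullet> \<xi>) - (H z *v \<xi>) \<bullet> \<xi> \<le> 0" for \<xi>
  proof -
    define \<rho> where "\<rho> t = (d + t *\<^sub>R \<xi>) \<bullet> (d + t *\<^sub>R \<xi>)" for t :: real
    define f where "f t = G (\<rho> t) - u (z + t *\<^sub>R \<xi>)" for t
    define f1 where "f1 t = - (1 / sqrt (\<rho> t + q (\<rho> t)) * ((d + t *\<^sub>R \<xi>) \<bullet> \<xi>)) - g (z + t *\<^sub>R \<xi>) \<bullet> \<xi>" for t
    have \<rho>0: "\<rho> 0 = s" by (simp add: \<rho>_def sd)
    have d\<rho>: "(\<rho> has_real_derivative 2 * ((d + t *\<^sub>R \<xi>) \<bullet> \<xi>)) (at t)" for t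
      unfolding \<rho>_def[abs_def] has_field_derivative_def
      by (auto intro!: derivative_eq_intros simp: inner_commute fun_eq_iff algebra_simps)
    have "(\<rho> \<longlongrightarrow> s) (nhds 0)"
      using DERIV_isCont[OF d\<rho>[of 0]] unfolding isCont_def tendsto_at_iff_tendsto_nhds unfolding \<rho>0 .
    then have "\<forall>\<^sub>F t in nhds 0. (G has_real_derivative - 1 / (2 * sqrt (\<rho> t + q (\<rho> t)))) (at (\<rho> t))"
      by (rule eventually_compose_filterlim[OF G])
    then have E1: "\<forall>\<^sub>F t in nhds 0. (f has_real_derivative f1 t) (at t)"
    proof eventually_elim
      case (elim t)
      from DERIV_diff[OF DERIV_chain2[OF elim d\<rho>] gradient_along_line[OF gradient, where x = z and t = t and \<xi> = \<xi>]]
      show ?case unfolding f_def[abs_def] f1_def by (simp add: field_simps)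
    qed
    have "((\<lambda>t. z + t *\<^sub>R \<xi>) \<longlongrightarrow> z + 0 *\<^sub>R \<xi>) (nhds (0::real))"
      by (intro tendsto_intros filterlim_ident)
    then have "((\<lambda>t. z + t *\<^sub>R \<xi>) \<longlongrightarrow> z) (nhds (0::real))" by simp
    then have "\<forall>\<^sub>F t in nhds 0. G ((norm (z + t *\<^sub>R \<xi> - x0))\<^sup>2) - u (z + t *\<^sub>R \<xi>) \<le> G s - u z"
      by (rule eventually_compose_filterlim[OF max])
    then have E2: "\<forall>\<^sub>F t in nhds 0. f t \<le> f 0"
    proof eventually_elim
      case (elim t)
      have "\<rho> t = (norm (z + t *\<^sub>R \<xi> - x0))\<^sup>2"
        by (simp add: \<rho>_def d_def power2_norm_eq_inner diff_add_eq)
      with elim show ?case by (simp add: f_def \<rho>0)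
    qed
    have "((\<lambda>r. 1 / sqrt (r + q r)) has_real_derivative - (1 + q') * h ^ 3 / 2) (at (\<rho> 0))"
    proof -
      have "((\<lambda>r. r + q r) has_real_derivative 1 + q') (at s)"
        by (intro DERIV_add DERIV_ident q)
      from DERIV_chain2[OF DERIV_real_sqrt this] sq
      have "((\<lambda>r. sqrt (r + q r)) has_real_derivative h / 2 * (1 + q')) (at s)"
        by (simp add: h_def field_simps)
      from DERIV_inverse_fun[OF this] sq
      have "((\<lambda>r. inverse (sqrt (r + q r))) has_real_derivative
          - (h * (h / 2 * (1 + q')) * h)) (at s)"
        by (simp add: h_def field_simps)
      moreover have "- (h * (h / 2 * (1 + q')) * h) = - (1 + q') * h ^ 3 / 2"
        by (simp add: power3_eq_cube) (simp add: algebra_simps)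
      ultimately show ?thesis unfolding \<rho>0 inverse_eq_divide by (simp only:)
    qed
    from DERIV_chain2[OF this d\<rho>]
    have A: "((\<lambda>t. 1 / sqrt (\<rho> t + q (\<rho> t))) has_real_derivative
        - ((1 + q') * h ^ 3 * (d \<bullet> \<xi>))) (at 0)"
      by (rule DERIV_cong) (simp add: field_simps)
    have Bd: "((\<lambda>t. (d + t *\<^sub>R \<xi>) \<bullet> \<xi>) has_real_derivative \<xi> \<bullet> \<xi>) (at 0)"
      unfolding has_field_derivative_def
      by (auto intro!: derivative_eq_intros simp: fun_eq_iff)
    have Cd: "((\<lambda>t. g (z + t *\<^sub>R \<xi>) \<bullet> \<xi>) has_real_derivative (H z *v \<xi>) \<bullet> \<xi>) (at 0)"
      using hessian_along_line[of g "H z" z 0 \<xi> \<xi>] hessian[of z] by simp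
    have E3: "(f1 has_real_derivative
        (1 + q') * h ^ 3 * (d \<bullet> \<xi>)\<^sup>2 - h * (\<xi> \<bullet> \<xi>) - (H z *v \<xi>) \<bullet> \<xi>) (at 0)"
      using DERIV_diff[OF DERIV_minus[OF DERIV_mult[OF A Bd]] Cd]
      unfolding f1_def[abs_def]
      by (rule DERIV_cong) (simp_all add: \<rho>0 h_def[symmetric] power2_eq_square algebra_simps)
    from second_derivative_test[OF E1 E3 E2]
    show "- (h * (d \<bullet> \<xi>)) - g z \<bullet> \<xi> = 0"
      "(1 + q') * h ^ 3 * (d \<bullet> \<xi>)\<^sup>2 - h * (\<xi> \<bullet> \<xi>) - (H z *v \<xi>) \<bullet> \<xi> \<le> 0"
      by (auto simp: f1_def \<rho>0 h_def)
  qed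
  have gz: "g z = - h *\<^sub>R d"
  proof (rule vector_eq_rdot[THEN iffD1, rule_format])
    show "g z \<bullet> \<xi> = (- h *\<^sub>R d) \<bullet> \<xi>" for \<xi> using along(1)[of \<xi>] by simp
  qed
  define k where "k = stretch ((norm (g z))\<^sup>2)"
  define \<xi> where "\<xi> i = axis i 1 + (k * g z $ i) *\<^sub>R g z" for i
  have P: "(norm (g z))\<^sup>2 = h\<^sup>2 * s" by (simp add: gz power_mult_distrib sd power2_norm_eq_inner)
  have P1: "1 - (norm (g z))\<^sup>2 = h\<^sup>2 * q s" using h2 P by (simp add: algebra_simps)
  have dg: "(d \<bullet> g z)\<^sup>2 = h\<^sup>2 * s\<^sup>2" by (simp add: gz sd power_mult_distrib)
  note fr = sum_rank_one_frame[of _ k "g z", folded \<xi>_def, unfolded k_def stretch_equation[OF norm_gradient_squared_less_1, of z], unfolded P1]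
  have b1: "bilinear (\<lambda>x y. (d \<bullet> x) * (d \<bullet> y))"
    unfolding bilinear_def by (auto intro!: linearI simp: inner_add_right algebra_simps)
  have S1: "(\<Sum>i\<in>UNIV. (d \<bullet> \<xi> i)\<^sup>2) = s + s\<^sup>2 / q s"
    using fr[OF b1] h0 q(2) sum_inner_axis_squared[of d] dg
    by (simp add: power2_eq_square[symmetric] s d_def[symmetric])
  have S2: "(\<Sum>i\<in>UNIV. \<xi> i \<bullet> \<xi> i) = real CARD('n) + s / q s"
    using fr[OF bilinear_inner] h0 q(2) P by (simp add: power2_norm_eq_inner inner_axis)
  have S3: "(\<Sum>i\<in>UNIV. (H z *v \<xi> i) \<bullet> \<xi> i) = - (u z powr p) * (h * sqrt (q s))"
    using equation_in_stretched_frame[of z] h0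
    by (simp add: \<xi>_def k_def P1 real_sqrt_mult)
  have "(\<Sum>i\<in>UNIV. (1 + q') * h ^ 3 * (d \<bullet> \<xi> i)\<^sup>2 - h * (\<xi> i \<bullet> \<xi> i) - (H z *v \<xi> i) \<bullet> \<xi> i) \<le> 0"
    by (intro sum_nonpos along(2))
  then have "(1 + q') * h ^ 3 * (s + s\<^sup>2 / q s) - h * (real CARD('n) + s / q s)
      + u z powr p * (h * sqrt (q s)) \<le> 0"
    by (simp add: sum_subtractf sum_distrib_left[symmetric] S1 S2 S3)
  moreover have "h ^ 3 * (s + s\<^sup>2 / q s) = h * (s / q s)"
  proof -
    have "h ^ 3 * (s + s\<^sup>2 / q s) = h * (h\<^sup>2 * (s + q s)) * (s / q s)"
      using q(2) by (simp add: field_simps power2_eq_square power3_eq_cube)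
    then show ?thesis by (simp add: h2)
  qed
  ultimately have "(1 + q') * (h * (s / q s)) - h * (real CARD('n) + s / q s)
      + u z powr p * (h * sqrt (q s)) \<le> 0"
    by (simp only: mult.assoc)
  then have "h * ((1 + q') * (s / q s) - (real CARD('n) + s / q s) + u z powr p * sqrt (q s)) \<le> 0"
    by (simp add: algebra_simps)
  then have "(1 + q') * (s / q s) - (real CARD('n) + s / q s) + u z powr p * sqrt (q s) \<le> 0"
    using h0 by (simp add: mult_le_0_iff)
  then show ?thesis by (simp add: algebra_simps add_divide_distrib)
qed

text \<open>
  Let \<open>M = u x0\<close> and compare on the ball of radius \<open>2 M\<close>. Since \<open>u\<close> is 1-Lipschitz, it is at least
  \<open>M / 2\<close> on the ball of radius \<open>M / 2\<close>. The Gaussian flux is tuned to that: its divergence changes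
  sign exactly at distance \<open>M / 2\<close>, and inside it is outweighed by \<open>(M / 2) powr p \<le> u powr p\<close>.
  So \<open>w - u\<close> has no interior maximum. For large \<open>M\<close> the barrier is nearly a light cone from close
  to the centre up to distance \<open>2 M\<close> and drops by more than \<open>M\<close>; as \<open>u \<ge> 0\<close> on the boundary sphere, the maximum
  does not lie on the boundary either.
\<close>
lemma height_bound:
  assumes "p \<ge> 0"
  shows "u x0 \<le> 2 + 2 * real CARD('n) * exp (8 * real CARD('n))"
proof (rule ccontr)
  define n where "n = real CARD('n)"
  define M where "M = u x0"
  assume "\<not> ?thesis"
  then have M: "M > 2 + 2 * n * exp (8 * n)" by (simp add: n_def M_def)
  have n: "n \<ge> 1" by (simp add: n_def Suc_le_eq)
  have M2: "M > 2" using M n by (smt (verit) exp_gt_zero mult_pos_pos)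
  define l where "l = 2 * n / M\<^sup>2"
  define c where "c = (M / 2) powr p / (2 * n)"
  define T where "T = (2 * M)\<^sup>2"
  define q where "q s = exp (2 * l * s) / c\<^sup>2" for s
  define b where "b = exp (8 * n) / c"
  have l0: "l > 0" and c0: "c > 0" and b0: "b > 0" and T0: "T > 0"
    using n M2 by (auto simp: l_def c_def b_def T_def)
  obtain G where G: "\<And>s. 0 \<le> s \<Longrightarrow> s \<le> T \<Longrightarrow>
      \<forall>\<^sub>F r in nhds s. (G has_real_derivative - 1 / (2 * sqrt (r + q r))) (at r)"
    using radial_profile_exists[of c l T] l0 c0 unfolding q_def by auto
  have G': "(G has_real_derivative - 1 / (2 * sqrt (s + q s))) (at s)" if "0 \<le> s" "s \<le> T" for s
    using eventually_nhds_x_imp_x[OF G[OF that]] .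
  have q0: "q s > 0" for s using c0 by (simp add: q_def)
  have qb: "q s \<le> b\<^sup>2" if "s \<le> T" for s
  proof -
    have "2 * l * s \<le> 2 * l * T" using that l0 by simp
    also have "\<dots> = 2 * (8 * n)" using M2 by (simp add: l_def T_def field_simps)
    finally have "exp (2 * l * s) \<le> (exp (8 * n))\<^sup>2" by (simp flip: exp_double)
    then show ?thesis by (simp add: q_def b_def power_divide divide_right_mono)
  qed
  have "(M / 2) powr p \<ge> 1" using M2 assms by (intro ge_one_powr_ge_zero) auto
  then have "2 * n / (M / 2) powr p \<le> 2 * n / 1" using n M2 by (intro divide_left_mono) auto
  then have "1 / c \<le> 2 * n" by (simp add: c_def)
  then have "exp (8 * n) * (1 / c) \<le> exp (8 * n) * (2 * n)" by (intro mult_left_mono) auto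
  then have bM: "b < M" using M by (simp add: b_def mult.commute)
  \<comment> \<open>The barrier drops by at least \<open>2 * M - b\<close>.\<close>
  have drop: "G 0 - G T > M"
  proof -
    have "2 * M \<le> sqrt (T + b\<^sup>2)" by (intro real_le_rsqrt) (simp add: T_def)
    with radial_profile_drop[of T G q b] G' q0 qb b0 T0 bM show ?thesis by force
  qed
  define f where "f y = G ((norm (y - x0))\<^sup>2) - u y" for y
  have range: "(norm (y - x0))\<^sup>2 \<in> {0..T}" if "y \<in> cball x0 (2 * M)" for y
  proof -
    have "norm (y - x0) \<le> 2 * M" using that by (simp add: dist_norm norm_minus_commute)
    then show ?thesis unfolding T_def using power_mono[of "norm (y - x0)" "2 * M" 2] by simp
  qed
  have "continuous_on {0..T} G"
    by (intro continuous_at_imp_continuous_on ballI DERIV_isCont[OF G']) auto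
  moreover have "continuous_on (cball x0 (2 * M)) (\<lambda>y. (norm (y - x0))\<^sup>2)"
    by (intro continuous_intros)
  ultimately have "continuous_on (cball x0 (2 * M)) (\<lambda>y. G ((norm (y - x0))\<^sup>2))"
    by (rule continuous_on_compose2) (use range in blast)
  then have "continuous_on (cball x0 (2 * M)) f"
    unfolding f_def by (intro continuous_on_diff continuous_u)
  then obtain z where z: "z \<in> cball x0 (2 * M)" "\<And>y. y \<in> cball x0 (2 * M) \<Longrightarrow> f y \<le> f z"
    using continuous_attains_sup[of "cball x0 (2 * M)" f] M2 by auto
  define s where "s = (norm (z - x0))\<^sup>2"
  have s: "0 \<le> s" "s \<le> T" using range[OF z(1)] by (auto simp: s_def)
  have "norm (z - x0) \<noteq> 2 * M"
  proof
    assume "norm (z - x0) = 2 * M"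
    then have "f z \<le> G T" using nonneg[of z] by (simp add: f_def T_def)
    moreover have "f x0 = G 0 - M" by (simp add: f_def M_def)
    ultimately show False using z(2)[of x0] M2 drop by auto
  qed
  then have "z \<in> ball x0 (2 * M)" using z(1) by (auto simp: dist_norm norm_minus_commute)
  then have "\<forall>\<^sub>F y in nhds z. y \<in> ball x0 (2 * M)" by (intro eventually_nhds_in_open) auto
  then have max: "\<forall>\<^sub>F y in nhds z. G ((norm (y - x0))\<^sup>2) - u y \<le> G s - u z"
    by eventually_elim (use z(2) in \<open>force simp: f_def s_def\<close>)
  have dq: "(q has_real_derivative 2 * l * q s) (at s)"
  proof -
    have "((\<lambda>s. exp (2 * l * s)) has_real_derivative exp (2 * l * s) * (2 * l)) (at s)"
      by (auto intro!: derivative_eq_intros)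
    from DERIV_cdivide[OF this, of "c\<^sup>2"] show ?thesis
      unfolding q_def[abs_def] by (simp add: mult.commute)
  qed
  from contact_with_radial_barrier[OF G[OF s] dq q0 s_def max] q0[of s]
  have key: "u z powr p * sqrt (q s) \<le> n - 2 * l * s" by (simp add: n_def algebra_simps)
  show False
  proof (cases "s \<le> (M / 2)\<^sup>2")
    case True
    then have "norm (z - x0) \<le> M / 2"
      unfolding s_def by (rule power2_le_imp_le) (use M2 in simp)
    then have "M / 2 \<le> u z" using lipschitz[of x0 z] by (simp add: M_def norm_minus_commute)
    then have "(M / 2) powr p \<le> u z powr p" using M2 assms by (intro powr_mono2) auto
    moreover have "1 / c \<le> sqrt (q s)"
      using c0 l0 s by (intro real_le_rsqrt) (simp add: q_def power_divide divide_right_mono)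
    ultimately have "(M / 2) powr p * (1 / c) \<le> u z powr p * sqrt (q s)"
      using c0 by (intro mult_mono) auto
    moreover have "(M / 2) powr p * (1 / c) = 2 * n" using M2 n by (simp add: c_def)
    moreover have "2 * l * s \<ge> 0" using l0 s by simp
    ultimately show False using key n by linarith
  next
    case False
    then have "2 * l * (M / 2)\<^sup>2 < 2 * l * s" using l0 by simp
    moreover have "2 * l * (M / 2)\<^sup>2 = n" using M2 by (simp add: l_def field_simps)
    moreover have "0 \<le> u z powr p * sqrt (q s)" using q0[of s] by simp
    ultimately show False using key by linarith
  qed
qed

end

section \<open>Maxima of the two-point function\<close>

context entire_solution
begin

text \<open>
  The function \<open>u x - u y - \<phi> \<bar>x - y\<bar>\<close> of two points is tested along all lines through \<open>(x, y)\<close>;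
  the direction \<open>(\<xi>, \<eta>)\<close> is at our disposal. The penalty \<open>\<epsilon> \<bar>x\<bar>\<^sup>2\<close>, which enforces the existence
  of a maximum, acts on \<open>x\<close> alone, so that the gradient at \<open>y\<close> is exactly parallel to \<open>x - y\<close>.
\<close>
lemma two_point_contact:
  assumes xy: "x \<noteq> y" and r: "r = norm (x - y)" and e: "e = (x - y) /\<^sub>R r"
    and \<phi>: "\<forall>\<^sub>F t in nhds r. (\<phi> has_real_derivative \<phi>1 t) (at t)"
    and \<phi>1: "(\<phi>1 has_real_derivative \<phi>2) (at r)"
    and max: "\<forall>\<^sub>F z in nhds (x, y).
      u (fst z) - u (snd z) - \<phi> (norm (fst z - snd z)) - \<epsilon> * (norm (fst z))\<^sup>2
      \<le> u x - u y - \<phi> r - \<epsilon> * (norm x)\<^sup>2"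
  shows "g y = \<phi>1 r *\<^sub>R e" and "g x = \<phi>1 r *\<^sub>R e + (2 * \<epsilon>) *\<^sub>R x"
    and "(H x *v \<xi>) \<bullet> \<xi> - (H y *v \<eta>) \<bullet> \<eta> \<le> \<phi>2 * (e \<bullet> (\<xi> - \<eta>))\<^sup>2
      + \<phi>1 r / r * ((\<xi> - \<eta>) \<bullet> (\<xi> - \<eta>) - (e \<bullet> (\<xi> - \<eta>))\<^sup>2) + 2 * \<epsilon> * (\<xi> \<bullet> \<xi>)"
proof -
  define d where "d = x - y"
  have r0: "r > 0" using xy r by simp
  have rd: "r = sqrt (d \<bullet> d)" by (simp add: r d_def norm_eq_sqrt_inner)
  have along: "g x \<bullet> \<xi> - g y \<bullet> \<eta> - \<phi>1 r * (e \<bullet> (\<xi> - \<eta>)) - 2 * \<epsilon> * (x \<bullet> \<xi>) = 0"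
    "(H x *v \<xi>) \<bullet> \<xi> - (H y *v \<eta>) \<bullet> \<eta> - (\<phi>2 * (e \<bullet> (\<xi> - \<eta>))\<^sup>2
      + \<phi>1 r / r * ((\<xi> - \<eta>) \<bullet> (\<xi> - \<eta>) - (e \<bullet> (\<xi> - \<eta>))\<^sup>2)) - 2 * \<epsilon> * (\<xi> \<bullet> \<xi>) \<le> 0" for \<xi> \<eta>
  proof -
    define \<zeta> where "\<zeta> = \<xi> - \<eta>"
    define N where "N t = sqrt ((d + t *\<^sub>R \<zeta>) \<bullet> (d + t *\<^sub>R \<zeta>))" for t :: real
    define f where "f t = u (x + t *\<^sub>R \<xi>) - u (y + t *\<^sub>R \<eta>) - \<phi> (N t)
      - \<epsilon> * ((x + t *\<^sub>R \<xi>) \<bullet> (x + t *\<^sub>R \<xi>))" for t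
    define f1 where "f1 t = g (x + t *\<^sub>R \<xi>) \<bullet> \<xi> - g (y + t *\<^sub>R \<eta>) \<bullet> \<eta>
      - \<phi>1 (N t) * (((d + t *\<^sub>R \<zeta>) \<bullet> \<zeta>) / N t) - 2 * \<epsilon> * ((x + t *\<^sub>R \<xi>) \<bullet> \<xi>)" for t
    have N0: "N 0 = r" by (simp add: N_def rd)
    have lin: "((\<lambda>t. (a + t *\<^sub>R b) \<bullet> b) has_real_derivative b \<bullet> b) (at t)" for a b :: "real ^ 'n" and t
      unfolding has_field_derivative_def
      by (auto intro!: derivative_eq_intros simp: fun_eq_iff)
    have quad: "((\<lambda>t. (a + t *\<^sub>R b) \<bullet> (a + t *\<^sub>R b)) has_real_derivative 2 * ((a + t *\<^sub>R b) \<bullet> b)) (at t)"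
      for a b :: "real ^ 'n" and t
      unfolding has_field_derivative_def
      by (auto intro!: derivative_eq_intros simp: inner_commute fun_eq_iff algebra_simps)
    have dN: "(N has_real_derivative ((d + t *\<^sub>R \<zeta>) \<bullet> \<zeta>) / N t) (at t)" if "N t > 0" for t
    proof -
      have "(d + t *\<^sub>R \<zeta>) \<bullet> (d + t *\<^sub>R \<zeta>) > 0" using that unfolding N_def by simp
      from DERIV_chain2[OF DERIV_real_sqrt[OF this] quad]
      show ?thesis unfolding N_def[abs_def] by (simp add: field_simps)
    qed
    have lim: "(N \<longlongrightarrow> r) (nhds 0)"
      using DERIV_isCont[OF dN[of 0]] r0 N0 unfolding isCont_def tendsto_at_iff_tendsto_nhds by simp
    have ev\<phi>: "\<forall>\<^sub>F t in nhds 0. (\<phi> has_real_derivative \<phi>1 (N t)) (at (N t))"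
      by (rule eventually_compose_filterlim[OF \<phi> lim])
    have evN: "\<forall>\<^sub>F t in nhds 0. N t > 0" using order_tendstoD(1)[OF lim r0] .
    from ev\<phi> evN have E1: "\<forall>\<^sub>F t in nhds 0. (f has_real_derivative f1 t) (at t)"
    proof eventually_elim
      case (elim t)
      from DERIV_diff[OF DERIV_diff[OF DERIV_diff[OF gradient_along_line[OF gradient, where x = x and t = t and \<xi> = \<xi>]
          gradient_along_line[OF gradient, where x = y and t = t and \<xi> = \<eta>]] DERIV_chain2[OF elim(1) dN[OF elim(2)]]]
          DERIV_cmult[OF quad[where a = x and b = \<xi> and t = t], where c = \<epsilon>]]
      show ?case unfolding f_def[abs_def] f1_def by (simp add: mult.left_commute mult.assoc)
    qed
    have "((\<lambda>t. (x + t *\<^sub>R \<xi>, y + t *\<^sub>R \<eta>)) \<longlongrightarrow> (x + 0 *\<^sub>R \<xi>, y + 0 *\<^sub>R \<eta>)) (nhds (0::real))"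
      by (intro tendsto_intros filterlim_ident)
    then have "((\<lambda>t. (x + t *\<^sub>R \<xi>, y + t *\<^sub>R \<eta>)) \<longlongrightarrow> (x, y)) (nhds (0::real))" by simp
    from this[unfolded filterlim_iff, rule_format, OF max]
    have E2: "\<forall>\<^sub>F t in nhds 0. f t \<le> f 0"
    proof eventually_elim
      case (elim t)
      have "N t = norm (x + t *\<^sub>R \<xi> - (y + t *\<^sub>R \<eta>))"
        by (simp add: N_def norm_eq_sqrt_inner d_def \<zeta>_def algebra_simps)
      with elim show ?case by (simp add: f_def N0 power2_norm_eq_inner)
    qed
    have hess: "((\<lambda>t. g (z + t *\<^sub>R \<nu>) \<bullet> \<nu>) has_real_derivative (H z *v \<nu>) \<bullet> \<nu>) (at 0)" for z \<nu>
      using hessian_along_line[of g "H z" z 0 \<nu> \<nu>] hessian[of z] by simp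
    have dN0: "(N has_real_derivative (d \<bullet> \<zeta>) / r) (at 0)" using dN[of 0] r0 N0 by simp
    have A: "((\<lambda>t. \<phi>1 (N t)) has_real_derivative \<phi>2 * ((d \<bullet> \<zeta>) / r)) (at 0)"
      using DERIV_chain2[of \<phi>1 \<phi>2 N 0, OF _ dN0] \<phi>1 N0 by simp
    have B: "((\<lambda>t. ((d + t *\<^sub>R \<zeta>) \<bullet> \<zeta>) / N t) has_real_derivative
        ((\<zeta> \<bullet> \<zeta>) * r - (d \<bullet> \<zeta>) * ((d \<bullet> \<zeta>) / r)) / (r * r)) (at 0)"
      using DERIV_divide[OF lin[where a = d and b = \<zeta> and t = 0] dN0] r0 N0 by simp
    have ed: "d \<bullet> \<zeta> = r * (e \<bullet> \<zeta>)" using r0 by (simp add: e d_def)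
    have E3: "(f1 has_real_derivative
        (H x *v \<xi>) \<bullet> \<xi> - (H y *v \<eta>) \<bullet> \<eta> - (\<phi>2 * (e \<bullet> \<zeta>)\<^sup>2
      + \<phi>1 r / r * (\<zeta> \<bullet> \<zeta> - (e \<bullet> \<zeta>)\<^sup>2)) - 2 * \<epsilon> * (\<xi> \<bullet> \<xi>)) (at 0)"
      using DERIV_diff[OF DERIV_diff[OF DERIV_diff[OF hess[of x \<xi>] hess[of y \<eta>]] DERIV_mult[OF A B]]
        DERIV_cmult[OF lin[where a = x and b = \<xi> and t = 0], where c = "2 * \<epsilon>"]]
      unfolding f1_def[abs_def]
    proof (rule DERIV_cong)
      have "(d + 0 *\<^sub>R \<zeta>) \<bullet> \<zeta> / N 0 = e \<bullet> \<zeta>" "d \<bullet> \<zeta> / r = e \<bullet> \<zeta>"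
        using r0 by (simp_all add: N0 ed)
      moreover have "((\<zeta> \<bullet> \<zeta>) * r - (d \<bullet> \<zeta>) * (e \<bullet> \<zeta>)) / (r * r) = (\<zeta> \<bullet> \<zeta> - (e \<bullet> \<zeta>)\<^sup>2) / r"
        using r0 unfolding ed by (simp add: power2_eq_square divide_simps) (simp add: algebra_simps)
      ultimately show "(H x *v \<xi>) \<bullet> \<xi> - (H y *v \<eta>) \<bullet> \<eta>
          - (\<phi>2 * (d \<bullet> \<zeta> / r) * ((d + 0 *\<^sub>R \<zeta>) \<bullet> \<zeta> / N 0)
            + (\<zeta> \<bullet> \<zeta> * r - d \<bullet> \<zeta> * (d \<bullet> \<zeta> / r)) / (r * r) * \<phi>1 (N 0)) - 2 * \<epsilon> * (\<xi> \<bullet> \<xi>)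
        = (H x *v \<xi>) \<bullet> \<xi> - (H y *v \<eta>) \<bullet> \<eta> - (\<phi>2 * (e \<bullet> \<zeta>)\<^sup>2
          + \<phi>1 r / r * (\<zeta> \<bullet> \<zeta> - (e \<bullet> \<zeta>)\<^sup>2)) - 2 * \<epsilon> * (\<xi> \<bullet> \<xi>)"
        by (simp add: N0 power2_eq_square)
    qed
    from second_derivative_test[OF E1 E3 E2] r0
    show "g x \<bullet> \<xi> - g y \<bullet> \<eta> - \<phi>1 r * (e \<bullet> (\<xi> - \<eta>)) - 2 * \<epsilon> * (x \<bullet> \<xi>) = 0"
      "(H x *v \<xi>) \<bullet> \<xi> - (H y *v \<eta>) \<bullet> \<eta> - (\<phi>2 * (e \<bullet> (\<xi> - \<eta>))\<^sup>2
      + \<phi>1 r / r * ((\<xi> - \<eta>) \<bullet> (\<xi> - \<eta>) - (e \<bullet> (\<xi> - \<eta>))\<^sup>2)) - 2 * \<epsilon> * (\<xi> \<bullet> \<xi>) \<le> 0"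
      by (auto simp: f1_def N0 ed \<zeta>_def[symmetric])
  qed
  show "g y = \<phi>1 r *\<^sub>R e"
  proof (rule vector_eq_rdot[THEN iffD1, rule_format])
    show "g y \<bullet> \<eta> = (\<phi>1 r *\<^sub>R e) \<bullet> \<eta>" for \<eta> using along(1)[of 0 \<eta>] by simp
  qed
  show "g x = \<phi>1 r *\<^sub>R e + (2 * \<epsilon>) *\<^sub>R x"
  proof (rule vector_eq_rdot[THEN iffD1, rule_format])
    show "g x \<bullet> \<xi> = (\<phi>1 r *\<^sub>R e + (2 * \<epsilon>) *\<^sub>R x) \<bullet> \<xi>" for \<xi>
      using along(1)[of \<xi> 0] by (simp add: inner_add_left)
  qed
  show "(H x *v \<xi>) \<bullet> \<xi> - (H y *v \<eta>) \<bullet> \<eta> \<le> \<phi>2 * (e \<bullet> (\<xi> - \<eta>))\<^sup>2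
      + \<phi>1 r / r * ((\<xi> - \<eta>) \<bullet> (\<xi> - \<eta>) - (e \<bullet> (\<xi> - \<eta>))\<^sup>2) + 2 * \<epsilon> * (\<xi> \<bullet> \<xi>)"
    using along(2)[of \<xi> \<eta>] by simp
qed

text \<open>
  The directions are summed over two frames, which produce the operators of the equation at \<open>x\<close>
  and at \<open>y\<close>: the columns of \<open>S\<^sub>x = I + k (g x \<otimes> g x)\<close> at \<open>x\<close> and those of
  \<open>I - m (e \<otimes> e) = S\<^sub>y R\<close> at \<open>y\<close>, where \<open>S\<^sub>y\<close> is the analogous square root at \<open>y\<close> and \<open>R\<close> is the
  reflection in the hyperplane orthogonal to \<open>e\<close>. If \<open>g x = g y\<close>, the reflection makes every
  \<open>\<xi> - \<eta>\<close> a multiple of \<open>e\<close>: only the second derivative of \<open>\<phi>\<close> survives, and it is counted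
  \<open>4 / (1 - \<bar>g y\<bar>\<^sup>2)\<close> times. No term of order \<open>1 / r\<close> is left, unlike for a barrier centred at \<open>y\<close>.
  Keeping both frames exact matters since the Hessians are not bounded: the small difference of
  the coefficients at \<open>x\<close> and \<open>y\<close> must never be multiplied by a Hessian.
\<close>
lemma two_point_inequality:
  assumes xy: "x \<noteq> y" and r: "r = norm (x - y)" and e: "e = (x - y) /\<^sub>R r"
    and \<phi>: "\<forall>\<^sub>F t in nhds r. (\<phi> has_real_derivative \<phi>1 t) (at t)"
    and \<phi>1: "(\<phi>1 has_real_derivative \<phi>2) (at r)"
    and max: "\<forall>\<^sub>F z in nhds (x, y).
      u (fst z) - u (snd z) - \<phi> (norm (fst z - snd z)) - \<epsilon> * (norm (fst z))\<^sup>2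
      \<le> u x - u y - \<phi> r - \<epsilon> * (norm x)\<^sup>2"
  defines "P \<equiv> (norm (g x))\<^sup>2" and "b \<equiv> g x \<bullet> e"
  defines "k \<equiv> stretch P" and "m \<equiv> 1 + 1 / sqrt (1 - (\<phi>1 r)\<^sup>2)"
  shows "- (u x powr p) * sqrt (1 - P) \<le> \<phi>2 * (k\<^sup>2 * P * b\<^sup>2 + 2 * k * m * b\<^sup>2 + m\<^sup>2)
    + \<phi>1 r / r * (k\<^sup>2 * P * (P - b\<^sup>2)) + 2 * \<epsilon> * (real CARD('n) + P / (1 - P))"
proof -
  note tp = two_point_contact[OF xy r e \<phi> \<phi>1 max]
  define \<xi> where "\<xi> i = axis i 1 + (k * g x $ i) *\<^sub>R g x" for i
  define \<eta> where "\<eta> i = axis i 1 + (- m * e $ i) *\<^sub>R e" for i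
  have e1: "norm e = 1" using xy by (simp add: e r)
  define w where "w = sqrt (1 - (\<phi>1 r)\<^sup>2)"
  have Q: "(norm (g y))\<^sup>2 = (\<phi>1 r)\<^sup>2" by (simp add: tp(1) e1)
  have w: "w > 0" "w\<^sup>2 = 1 - (\<phi>1 r)\<^sup>2"
    using norm_gradient_squared_less_1[of y] by (auto simp: w_def Q)
  have "P < 1" unfolding P_def by (rule norm_gradient_squared_less_1)
  have me: "2 * - m + (- m)\<^sup>2 * (norm e)\<^sup>2 = (\<phi>1 r)\<^sup>2 / (1 - (\<phi>1 r)\<^sup>2)"
  proof -
    have "2 * - m + (- m)\<^sup>2 * (norm e)\<^sup>2 = 1 / w\<^sup>2 - 1"
      unfolding m_def w_def[symmetric] e1 using w(1) by (simp add: power2_eq_square field_simps)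
    also have "\<dots> = (1 - w\<^sup>2) / w\<^sup>2" using w(1) by (simp add: field_simps)
    finally show ?thesis by (simp add: w(2))
  qed
  have "(\<Sum>i\<in>UNIV. (H y *v \<eta> i) \<bullet> \<eta> i)
      = (\<Sum>i\<in>UNIV. (H y *v axis i 1) \<bullet> axis i 1) + ((H y *v g y) \<bullet> g y) / (1 - (norm (g y))\<^sup>2)"
    unfolding \<eta>_def sum_rank_one_frame[OF bilinear_hessian] me Q
    by (simp add: tp(1) matrix_vector_mult_scaleR power2_eq_square)
  \<comment> \<open>At \<open>y\<close> only the sign of the nonlinearity is used, at \<open>x\<close> its size.\<close>
  also have "\<dots> \<le> 0"
    unfolding equation using norm_gradient_squared_less_1[of y] by simp
  finally have Y: "(\<Sum>i\<in>UNIV. (H y *v \<eta> i) \<bullet> \<eta> i) \<le> 0" .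
  have X: "(\<Sum>i\<in>UNIV. (H x *v \<xi> i) \<bullet> \<xi> i) = - (u x powr p) * sqrt (1 - P)"
    using equation_in_stretched_frame[of x] by (simp add: \<xi>_def k_def P_def)
  have S\<xi>: "(\<Sum>i\<in>UNIV. \<xi> i \<bullet> \<xi> i) = real CARD('n) + P / (1 - P)"
    unfolding \<xi>_def sum_rank_one_frame[OF bilinear_inner] k_def
    using stretch_equation[OF \<open>P < 1\<close>] by (simp add: P_def power2_norm_eq_inner inner_axis)
  have diff: "\<xi> i - \<eta> i = (k * g x $ i) *\<^sub>R g x + (m * e $ i) *\<^sub>R e" for i
    by (simp add: \<xi>_def \<eta>_def)
  have ee: "e \<bullet> e = 1" using e1 by (simp add: norm_eq_1)
  have gg: "g x \<bullet> g x = P" by (simp add: P_def power2_norm_eq_inner)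
  have comp: "(\<Sum>i\<in>UNIV. a $ i * c $ i) = a \<bullet> c" for a c :: "real ^ 'n" by (simp add: inner_vec_def)
  have "(e \<bullet> (\<xi> i - \<eta> i))\<^sup>2 = k\<^sup>2 * b\<^sup>2 * (g x $ i * g x $ i) + 2 * k * m * b * (g x $ i * e $ i)
      + m\<^sup>2 * (e $ i * e $ i)" for i
    by (simp add: diff inner_add_right ee b_def inner_commute power2_eq_square algebra_simps)
  then have S1: "(\<Sum>i\<in>UNIV. (e \<bullet> (\<xi> i - \<eta> i))\<^sup>2) = k\<^sup>2 * P * b\<^sup>2 + 2 * k * m * b\<^sup>2 + m\<^sup>2"
    by (simp add: sum.distrib sum_distrib_left[symmetric] comp gg ee b_def[symmetric] power2_eq_square)
  have "(\<xi> i - \<eta> i) \<bullet> (\<xi> i - \<eta> i) = k\<^sup>2 * P * (g x $ i * g x $ i) + 2 * k * m * b * (g x $ i * e $ i)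
      + m\<^sup>2 * (e $ i * e $ i)" for i
    by (simp add: diff inner_add_right inner_add_left ee gg b_def inner_commute power2_eq_square algebra_simps)
  then have S2: "(\<Sum>i\<in>UNIV. (\<xi> i - \<eta> i) \<bullet> (\<xi> i - \<eta> i)) = k\<^sup>2 * P * P + 2 * k * m * b\<^sup>2 + m\<^sup>2"
    by (simp add: sum.distrib sum_distrib_left[symmetric] comp gg ee b_def[symmetric] power2_eq_square)
  have "(\<Sum>i\<in>UNIV. (H x *v \<xi> i) \<bullet> \<xi> i) - (\<Sum>i\<in>UNIV. (H y *v \<eta> i) \<bullet> \<eta> i)
      \<le> (\<Sum>i\<in>UNIV. \<phi>2 * (e \<bullet> (\<xi> i - \<eta> i))\<^sup>2
        + \<phi>1 r / r * ((\<xi> i - \<eta> i) \<bullet> (\<xi> i - \<eta> i) - (e \<bullet> (\<xi> i - \<eta> i))\<^sup>2) + 2 * \<epsilon> * (\<xi> i \<bullet> \<xi> i))"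
    unfolding sum_subtractf[symmetric] by (intro sum_mono tp(3))
  also have "\<dots> = \<phi>2 * (k\<^sup>2 * P * b\<^sup>2 + 2 * k * m * b\<^sup>2 + m\<^sup>2)
    + \<phi>1 r / r * ((k\<^sup>2 * P * P + 2 * k * m * b\<^sup>2 + m\<^sup>2) - (k\<^sup>2 * P * b\<^sup>2 + 2 * k * m * b\<^sup>2 + m\<^sup>2))
    + 2 * \<epsilon> * (real CARD('n) + P / (1 - P))"
    by (simp only: sum.distrib sum_distrib_left[symmetric] sum_subtractf S1 S2 S\<xi>)
  finally show ?thesis using X Y by (simp add: algebra_simps)
qed

end

section \<open>The gradient estimate\<close>

text \<open>
  An arc of a hyperbola through the origin: a curve of constant curvature \<open>- 1 / a\<close> in the Lorentz
  plane, flat at \<open>t = L\<close>, with slope \<open>L / sqrt (a\<^sup>2 + L\<^sup>2) < 1\<close> at \<open>t = 0\<close>.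
\<close>
definition hyperbola :: "real \<Rightarrow> real \<Rightarrow> real \<Rightarrow> real" where
  "hyperbola a L t = sqrt (a\<^sup>2 + L\<^sup>2) - sqrt (a\<^sup>2 + (L - t)\<^sup>2)"

definition hyperbola_slope :: "real \<Rightarrow> real \<Rightarrow> real \<Rightarrow> real" where
  "hyperbola_slope a L t = (L - t) / sqrt (a\<^sup>2 + (L - t)\<^sup>2)"

definition hyperbola_bend :: "real \<Rightarrow> real \<Rightarrow> real \<Rightarrow> real" where
  "hyperbola_bend a L t = - a\<^sup>2 / sqrt (a\<^sup>2 + (L - t)\<^sup>2) ^ 3"

lemma DERIV_hyperbola:
  assumes "a > 0"
  shows "(hyperbola a L has_real_derivative hyperbola_slope a L t) (at t)"
    and "(hyperbola_slope a L has_real_derivative hyperbola_bend a L t) (at t)"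
proof -
  define D where "D t = sqrt (a\<^sup>2 + (L - t)\<^sup>2)" for t
  have pos: "a\<^sup>2 + (L - t)\<^sup>2 > 0" for t using assms by (simp add: add_pos_nonneg)
  have D: "D t > 0" "(D t)\<^sup>2 = a\<^sup>2 + (L - t)\<^sup>2" using pos[of t] by (auto simp: D_def)
  have "((\<lambda>t. a\<^sup>2 + (L - t)\<^sup>2) has_real_derivative - 2 * (L - t)) (at t)"
    by (auto intro!: derivative_eq_intros)
  from DERIV_chain2[OF DERIV_real_sqrt[OF pos] this]
  have dD: "(D has_real_derivative - (L - t) / D t) (at t)"
    unfolding D_def[abs_def]
  proof (rule DERIV_cong)
    have "inverse w / 2 * (- 2 * c) = - c / w" for w c :: real
      by (cases "w = 0") (auto simp: field_simps)
    then show "inverse (sqrt (a\<^sup>2 + (L - t)\<^sup>2)) / 2 * (- 2 * (L - t)) = - (L - t) / sqrt (a\<^sup>2 + (L - t)\<^sup>2)" .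
  qed
  show "(hyperbola a L has_real_derivative hyperbola_slope a L t) (at t)"
    using DERIV_diff[OF DERIV_const dD, of "sqrt (a\<^sup>2 + L\<^sup>2)"]
    unfolding hyperbola_def[abs_def] hyperbola_slope_def D_def by (simp add: minus_divide_left)
  have "((\<lambda>t. L - t) has_real_derivative - 1) (at t)"
    by (auto intro!: derivative_eq_intros)
  from DERIV_divide[OF this dD] D(1)
  have "((\<lambda>t. (L - t) / D t) has_real_derivative (- D t - (L - t) * (- (L - t) / D t)) / (D t * D t)) (at t)"
    by simp
  also have "(- D t - (L - t) * (- (L - t) / D t)) / (D t * D t) = ((L - t)\<^sup>2 - (D t)\<^sup>2) / D t ^ 3"
    using D(1) by (simp add: field_simps power2_eq_square power3_eq_cube)
  also have "\<dots> = - a\<^sup>2 / D t ^ 3" by (simp add: D(2))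
  finally show "(hyperbola_slope a L has_real_derivative hyperbola_bend a L t) (at t)"
    unfolding hyperbola_slope_def[abs_def] hyperbola_bend_def D_def .
qed

lemma hyperbola_bounds:
  assumes "a > 0" "0 \<le> t" "t \<le> L"
  shows "0 \<le> hyperbola a L t"
    and "hyperbola a L t \<le> L / sqrt (a\<^sup>2 + L\<^sup>2) * t"
proof -
  have "(L - t)\<^sup>2 \<le> L\<^sup>2" using assms by (intro power_mono) auto
  then show "0 \<le> hyperbola a L t" by (simp add: hyperbola_def)
  define A where "A = sqrt (a\<^sup>2 + L\<^sup>2)"
  have A: "A > 0" "A\<^sup>2 = a\<^sup>2 + L\<^sup>2" using assms by (auto simp: A_def add_pos_nonneg)
  have "(a * a + L * (L - t))\<^sup>2 \<le> (a\<^sup>2 + L\<^sup>2) * (a\<^sup>2 + (L - t)\<^sup>2)"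
  proof -
    have "(a\<^sup>2 + L\<^sup>2) * (a\<^sup>2 + (L - t)\<^sup>2) - (a * a + L * (L - t))\<^sup>2 = (a * t)\<^sup>2"
      by (simp add: power2_eq_square algebra_simps)
    then show ?thesis by (smt (verit) zero_le_power2)
  qed
  then have "a * a + L * (L - t) \<le> A * sqrt (a\<^sup>2 + (L - t)\<^sup>2)"
    unfolding A_def real_sqrt_mult[symmetric] by (rule real_le_rsqrt)
  then have "A\<^sup>2 - L * t \<le> A * sqrt (a\<^sup>2 + (L - t)\<^sup>2)"
    unfolding A(2) by (simp add: power2_eq_square algebra_simps)
  then have "A - L / A * t \<le> sqrt (a\<^sup>2 + (L - t)\<^sup>2)"
    using A(1) by (simp add: field_simps power2_eq_square)
  then show "hyperbola a L t \<le> L / sqrt (a\<^sup>2 + L\<^sup>2) * t"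
    by (simp add: hyperbola_def A_def)
qed

lemma hyperbola_end:
  assumes "a > 0" "C > 0" "L = C + a"
  shows "C \<le> hyperbola a L L"
proof -
  have "L \<le> sqrt (a\<^sup>2 + L\<^sup>2)" by (intro real_le_rsqrt) simp
  moreover have "hyperbola a L L = sqrt (a\<^sup>2 + L\<^sup>2) - a" using assms(1) by (simp add: hyperbola_def)
  ultimately show ?thesis using assms(3) by linarith
qed

text \<open>
  The limit of the two-point inequality as the penalty disappears. Along a subsequence
  both \<open>\<alpha>\<close> and \<open>b\<close> tend to the slope \<open>S\<close> of the hyperbola at a limit distance \<open>m\<close>, and the inequality becomes
  \<open>- B w \<le> 4 \<phi>'' / w\<^sup>2\<close> with \<open>w = sqrt (1 - S\<^sup>2)\<close>. Since \<open>\<phi>'' / w ^ 3 = - 1 / a\<close>, it says \<open>4 \<le> B a\<close>.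
  The lower bound \<open>\<delta>\<close> for the distances keeps the term with \<open>1 / r\<close> under control.
\<close>
lemma concavity_excludes_limit:
  fixes r \<alpha> b \<epsilon> :: "nat \<Rightarrow> real"
  assumes a: "a > 0" "B * a < 4" and \<delta>: "\<delta> > 0"
    and r: "\<And>j. \<delta> \<le> r j \<and> r j \<le> L"
    and \<epsilon>: "\<epsilon> \<longlonglongrightarrow> 0"
    and \<alpha>: "(\<lambda>j. \<alpha> j - hyperbola_slope a L (r j)) \<longlonglongrightarrow> 0"
    and b: "(\<lambda>j. b j - hyperbola_slope a L (r j)) \<longlonglongrightarrow> 0"
    and ineq: "\<And>j. - B * sqrt (1 - (\<alpha> j)\<^sup>2) \<le> hyperbola_bend a L (r j) *
        ((stretch ((\<alpha> j)\<^sup>2))\<^sup>2 * (\<alpha> j)\<^sup>2 * (b j)\<^sup>2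
        + 2 * stretch ((\<alpha> j)\<^sup>2) * (1 + 1 / sqrt (1 - (hyperbola_slope a L (r j))\<^sup>2)) * (b j)\<^sup>2
        + (1 + 1 / sqrt (1 - (hyperbola_slope a L (r j))\<^sup>2))\<^sup>2)
      + hyperbola_slope a L (r j) / r j * ((stretch ((\<alpha> j)\<^sup>2))\<^sup>2 * (\<alpha> j)\<^sup>2 * ((\<alpha> j)\<^sup>2 - (b j)\<^sup>2))
      + 2 * \<epsilon> j * (N + (\<alpha> j)\<^sup>2 / (1 - (\<alpha> j)\<^sup>2))"
  shows False
proof -
  have "seq_compact {\<delta>..L}" by (intro compact_imp_seq_compact compact_Icc)
  then obtain m \<sigma> where m: "m \<in> {\<delta>..L}" and \<sigma>: "strict_mono \<sigma>" and rm: "(r \<circ> \<sigma>) \<longlonglongrightarrow> m"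
    using r unfolding seq_compact_def by (metis atLeastAtMost_iff)
  have rm: "(\<lambda>j. r (\<sigma> j)) \<longlonglongrightarrow> m" using rm by (simp add: o_def)
  define D where "D = sqrt (a\<^sup>2 + (L - m)\<^sup>2)"
  have D: "D > 0" "D\<^sup>2 = a\<^sup>2 + (L - m)\<^sup>2" using a by (auto simp: D_def add_pos_nonneg)
  define S where "S = hyperbola_slope a L m"
  have S2: "1 - S\<^sup>2 = (a / D)\<^sup>2"
  proof -
    have "1 - S\<^sup>2 = 1 - (L - m)\<^sup>2 / D\<^sup>2"
      by (simp add: S_def hyperbola_slope_def D_def[symmetric] power_divide)
    also have "\<dots> = (D\<^sup>2 - (L - m)\<^sup>2) / D\<^sup>2" using D(1) by (simp add: diff_divide_distrib)
    finally show ?thesis using D(2) by (simp add: power_divide)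
  qed
  have w: "sqrt (1 - S\<^sup>2) = a / D" using a D by (simp add: S2)
  have S1: "1 - S\<^sup>2 > 0" using a D by (simp add: S2)
  have sl: "(\<lambda>j. hyperbola_slope a L (r (\<sigma> j))) \<longlonglongrightarrow> S"
    unfolding S_def by (rule isCont_tendsto_compose[OF DERIV_isCont[OF DERIV_hyperbola(2)[OF a(1)]] rm])
  have be: "(\<lambda>j. hyperbola_bend a L (r (\<sigma> j))) \<longlonglongrightarrow> hyperbola_bend a L m"
    unfolding hyperbola_bend_def using D(1)
    by (intro tendsto_intros rm) (auto simp: D_def)
  have al: "(\<lambda>j. \<alpha> (\<sigma> j)) \<longlonglongrightarrow> S"
    using tendsto_add[OF LIMSEQ_subseq_LIMSEQ[OF \<alpha> \<sigma>] sl] by (simp add: o_def)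
  have bl: "(\<lambda>j. b (\<sigma> j)) \<longlonglongrightarrow> S"
    using tendsto_add[OF LIMSEQ_subseq_LIMSEQ[OF b \<sigma>] sl] by (simp add: o_def)
  have el: "(\<lambda>j. \<epsilon> (\<sigma> j)) \<longlonglongrightarrow> 0"
    using LIMSEQ_subseq_LIMSEQ[OF \<epsilon> \<sigma>] by (simp add: o_def)
  have wpos: "sqrt (1 - S\<^sup>2) > 0" using S1 by simp
  have st: "(\<lambda>j. stretch ((\<alpha> (\<sigma> j))\<^sup>2)) \<longlonglongrightarrow> stretch (S\<^sup>2)"
    unfolding stretch_def using wpos by (intro tendsto_intros al) (auto simp: add_pos_pos less_imp_neq[symmetric])
  have "- B * sqrt (1 - S\<^sup>2) \<le> hyperbola_bend a L m *
        ((stretch (S\<^sup>2))\<^sup>2 * S\<^sup>2 * S\<^sup>2 + 2 * stretch (S\<^sup>2) * (1 + 1 / sqrt (1 - S\<^sup>2)) * S\<^sup>2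
        + (1 + 1 / sqrt (1 - S\<^sup>2))\<^sup>2)
      + S / m * ((stretch (S\<^sup>2))\<^sup>2 * S\<^sup>2 * (S\<^sup>2 - S\<^sup>2)) + 2 * 0 * (N + S\<^sup>2 / (1 - S\<^sup>2))"
    (is "?l \<le> ?r")
  proof (rule LIMSEQ_le)
    show "(\<lambda>j. - B * sqrt (1 - (\<alpha> (\<sigma> j))\<^sup>2)) \<longlonglongrightarrow> ?l" by (intro tendsto_intros al)
    show "(\<lambda>j. hyperbola_bend a L (r (\<sigma> j)) *
        ((stretch ((\<alpha> (\<sigma> j))\<^sup>2))\<^sup>2 * (\<alpha> (\<sigma> j))\<^sup>2 * (b (\<sigma> j))\<^sup>2
        + 2 * stretch ((\<alpha> (\<sigma> j))\<^sup>2) * (1 + 1 / sqrt (1 - (hyperbola_slope a L (r (\<sigma> j)))\<^sup>2)) * (b (\<sigma> j))\<^sup>2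
        + (1 + 1 / sqrt (1 - (hyperbola_slope a L (r (\<sigma> j)))\<^sup>2))\<^sup>2)
      + hyperbola_slope a L (r (\<sigma> j)) / r (\<sigma> j)
        * ((stretch ((\<alpha> (\<sigma> j))\<^sup>2))\<^sup>2 * (\<alpha> (\<sigma> j))\<^sup>2 * ((\<alpha> (\<sigma> j))\<^sup>2 - (b (\<sigma> j))\<^sup>2))
      + 2 * \<epsilon> (\<sigma> j) * (N + (\<alpha> (\<sigma> j))\<^sup>2 / (1 - (\<alpha> (\<sigma> j))\<^sup>2))) \<longlonglongrightarrow> ?r"
      by (intro tendsto_intros al bl el sl be st rm) (use S1 wpos m \<delta> in auto)
  qed (use ineq in blast)
  also have "?r = hyperbola_bend a L m * (stretch (S\<^sup>2) * S\<^sup>2 + (1 + D / a))\<^sup>2"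
  proof -
    have "k\<^sup>2 * Q * Q + 2 * k * m * Q + m\<^sup>2 = (k * Q + m)\<^sup>2" for k Q m :: real
      by (simp add: power2_eq_square algebra_simps)
    then show ?thesis by (simp add: w)
  qed
  also have "stretch (S\<^sup>2) * S\<^sup>2 = D / a - 1"
  proof -
    define v where "v = a / D"
    have v: "v > 0" "S\<^sup>2 = (1 - v) * (1 + v)" "1 + v > 0"
      using a D S2 by (auto simp: v_def power2_eq_square algebra_simps add_pos_pos)
    have "stretch (S\<^sup>2) = 1 / (v * (1 + v))"
      by (simp add: stretch_def w v_def[symmetric])
    then have "stretch (S\<^sup>2) * S\<^sup>2 = ((1 - v) * (1 + v)) / (v * (1 + v))"
      by (simp only: v(2)) simp
    also have "\<dots> = (1 - v) / v" using v(3) by simp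
    also have "\<dots> = D / a - 1" using a D by (simp add: v_def field_simps)
    finally show ?thesis .
  qed
  also have "hyperbola_bend a L m * (D / a - 1 + (1 + D / a))\<^sup>2 = - 4 / D"
  proof -
    have "D / a - 1 + (1 + D / a) = 2 * D / a" by simp
    then show ?thesis
      unfolding hyperbola_bend_def D_def[symmetric]
      using a D(1) by (simp add: power2_eq_square power3_eq_cube)
  qed
  finally have "- B * (a / D) \<le> - 4 / D" unfolding w .
  then have "4 \<le> B * a" using D(1) by (simp add: field_simps)
  with a(2) show False by simp
qed

context entire_solution
begin

text \<open>
  If the inequality fails by \<open>2 \<delta>\<close> somewhere, then for every small penalty the penalized two-point function
  has a maximum, with value at least \<open>\<delta>\<close> among the pairs at distance at most \<open>L\<close>. The distance \<open>L\<close>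
  itself is excluded because the hyperbola has there reached the bound \<open>C\<close> of \<open>u\<close>, and distances
  below \<open>\<delta>\<close> are excluded because \<open>u\<close> is 1-Lipschitz. So the maximum is interior and the two-point
  inequality applies; the penalties tend to zero.
\<close>
lemma two_point_comparison:
  assumes a: "a > 0" "B * a < 4" and C: "C > 0" "\<And>x. u x \<le> C" and L: "L = C + a"
    and B: "\<And>x. u x powr p \<le> B"
    and xy: "norm (x - y) \<le> L"
  shows "u x - u y \<le> hyperbola a L (norm (x - y))"
proof (rule ccontr)
  assume violation: "\<not> ?thesis"
  define \<delta> where "\<delta> = (u x - u y - hyperbola a L (norm (x - y))) / 2"
  have \<delta>: "\<delta> > 0" using violation by (simp add: \<delta>_def)
  \<comment> \<open>Scaled so that the penalty costs at most \<open>\<delta>\<close> at the given point \<open>x\<close>.\<close>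
  define \<epsilon> where "\<epsilon> j = \<delta> / (1 + (norm x)\<^sup>2) / real (Suc j)" for j
  have x1: "1 + (norm x)\<^sup>2 > 0" by (simp add: add_pos_nonneg)
  have \<epsilon>0: "\<epsilon> j > 0" for j using \<delta> x1 by (simp add: \<epsilon>_def)
  have \<epsilon>x: "\<epsilon> j * (norm x)\<^sup>2 \<le> \<delta>" for j
  proof -
    have "(norm x)\<^sup>2 \<le> (1 + (norm x)\<^sup>2) * real (Suc j)"
    proof -
      have "(1 + (norm x)\<^sup>2) * 1 \<le> (1 + (norm x)\<^sup>2) * real (Suc j)"
        using x1 by (intro mult_left_mono) auto
      then show ?thesis by (simp only: mult_1_right)
    qed
    then have "\<delta> * (norm x)\<^sup>2 \<le> \<delta> * ((1 + (norm x)\<^sup>2) * real (Suc j))"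
      using \<delta> by (intro mult_left_mono) auto
    moreover have "(1 + (norm x)\<^sup>2) * real (Suc j) > 0" using x1 by simp
    ultimately show ?thesis unfolding \<epsilon>_def by (simp add: pos_divide_le_eq)
  qed
  have \<epsilon>lim: "\<epsilon> \<longlonglongrightarrow> 0"
    unfolding \<epsilon>_def[abs_def]
    by (rule real_tendsto_divide_at_top[OF tendsto_const
          filterlim_compose[OF filterlim_real_sequentially filterlim_Suc]])
  define Z where "Z j z = u (fst z) - u (snd z) - hyperbola a L (norm (fst z - snd z))
    - \<epsilon> j * (norm (fst z))\<^sup>2" for j z
  have "\<exists>z. norm (fst z - snd z) \<le> L \<and> \<delta> \<le> Z j z \<and> (\<forall>z'. norm (fst z' - snd z') \<le> L \<longrightarrow> Z j z' \<le> Z j z)" for j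
  proof -
    \<comment> \<open>Beyond the second of these radii the penalty is at least the bound \<open>C\<close> of \<open>u\<close>.\<close>
    define R where "R = max (norm x) (sqrt (C / \<epsilon> j))"
    define K where "K = {z :: (real ^ 'n) \<times> (real ^ 'n). norm (fst z - snd z) \<le> L} \<inter> cball 0 R \<times> cball 0 (R + L)"
    have "closed {z :: (real ^ 'n) \<times> (real ^ 'n). norm (fst z - snd z) \<le> L}"
      by (intro closed_Collect_le continuous_intros)
    then have "compact K" unfolding K_def by (intro closed_Int_compact compact_Times compact_cball)
    have inK: "z \<in> K" if "norm (fst z - snd z) \<le> L" "norm (fst z) \<le> R" for z
      using that norm_triangle_ineq4[of "fst z" "fst z - snd z"] by (auto simp: K_def mem_Times_iff)
    have Kin: "norm (fst z - snd z) \<le> L" if "z \<in> K" for z using that by (simp add: K_def)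
    have xK: "(x, y) \<in> K" using xy by (intro inK) (auto simp: R_def)
    have "continuous_on UNIV (hyperbola a L)"
      by (intro continuous_at_imp_continuous_on ballI DERIV_isCont[OF DERIV_hyperbola(1)[OF a(1)]])
    then have "continuous_on K (\<lambda>z. hyperbola a L (norm (fst z - snd z)))"
      by (rule continuous_on_compose2) (auto intro!: continuous_intros)
    moreover have "continuous_on K (\<lambda>z. u (fst z))" "continuous_on K (\<lambda>z. u (snd z))"
      by (rule continuous_on_compose2[OF continuous_u[of UNIV]]; auto intro!: continuous_intros)+
    ultimately have "continuous_on K (Z j)"
      unfolding Z_def by (intro continuous_on_diff continuous_on_mult continuous_on_const
          continuous_on_power continuous_on_norm continuous_on_fst continuous_on_id)
    then obtain z where z: "z \<in> K" "\<And>z'. z' \<in> K \<Longrightarrow> Z j z' \<le> Z j z"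
      using continuous_attains_sup[OF \<open>compact K\<close>] xK by blast
    have "Z j (x, y) \<ge> \<delta>" using \<epsilon>x[of j] by (simp add: Z_def \<delta>_def field_simps)
    then have zd: "Z j z \<ge> \<delta>" using z(2)[OF xK] by simp
    have "Z j z' \<le> Z j z" if z': "norm (fst z' - snd z') \<le> L" for z'
    proof (cases "norm (fst z') \<le> R")
      case True then show ?thesis using inK z' z(2) by blast
    next
      case False
      then have "sqrt (C / \<epsilon> j) \<le> norm (fst z')" by (simp add: R_def)
      then have "C / \<epsilon> j \<le> (norm (fst z'))\<^sup>2" by (rule sqrt_le_D)
      then have "C \<le> \<epsilon> j * (norm (fst z'))\<^sup>2" using \<epsilon>0[of j] by (simp add: field_simps)
      moreover have "0 \<le> hyperbola a L (norm (fst z' - snd z'))"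
        using z' a by (intro hyperbola_bounds) auto
      ultimately have "Z j z' \<le> 0" using C(2)[of "fst z'"] nonneg[of "snd z'"] by (simp add: Z_def)
      then show ?thesis using zd \<delta> by simp
    qed
    then show ?thesis using Kin[OF z(1)] zd by blast
  qed
  then obtain z where zL: "\<And>j. norm (fst (z j) - snd (z j)) \<le> L" and z\<delta>: "\<And>j. \<delta> \<le> Z j (z j)"
    and zmax: "\<And>j z'. norm (fst z' - snd z') \<le> L \<Longrightarrow> Z j z' \<le> Z j (z j)" by metis
  define X where "X j = fst (z j)" for j
  define Y where "Y j = snd (z j)" for j
  define r where "r j = norm (X j - Y j)" for j
  define e where "e j = (X j - Y j) /\<^sub>R r j" for j
  have zXY: "z j = (X j, Y j)" for j by (simp add: X_def Y_def)
  have rL: "r j \<le> L" for j using zL by (simp add: r_def X_def Y_def)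
  have hpos: "0 \<le> hyperbola a L (r j)" for j
    using rL a by (intro hyperbola_bounds) (auto simp: r_def)
  have ZXY: "\<delta> \<le> u (X j) - u (Y j) - hyperbola a L (r j) - \<epsilon> j * (norm (X j))\<^sup>2" for j
    using z\<delta>[of j] by (simp add: Z_def X_def Y_def r_def)
  have r\<delta>: "\<delta> \<le> r j" for j
    using ZXY[of j] hpos[of j] lipschitz[of "X j" "Y j"] \<epsilon>0[of j]
    by (smt (verit) r_def mult_nonneg_nonneg zero_le_power2)
  have r0: "r j > 0" for j using r\<delta>[of j] \<delta> by simp
  have XC: "\<epsilon> j * (norm (X j))\<^sup>2 \<le> C" for j
    using ZXY[of j] hpos[of j] C(2)[of "X j"] nonneg[of "Y j"] \<delta> by linarith
  have rltL: "r j < L" for j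
  proof (rule ccontr)
    assume "\<not> r j < L"
    then have "r j = L" using rL[of j] by simp
    then have "C \<le> hyperbola a L (r j)" using hyperbola_end[OF a(1) C(1) L] by simp
    moreover have "0 \<le> \<epsilon> j * (norm (X j))\<^sup>2" using \<epsilon>0[of j] by simp
    ultimately show False using ZXY[of j] C(2)[of "X j"] nonneg[of "Y j"] \<delta> by linarith
  qed
  have max: "\<forall>\<^sub>F w in nhds (X j, Y j). u (fst w) - u (snd w) - hyperbola a L (norm (fst w - snd w))
      - \<epsilon> j * (norm (fst w))\<^sup>2 \<le> u (X j) - u (Y j) - hyperbola a L (r j) - \<epsilon> j * (norm (X j))\<^sup>2" for j
  proof -
    have "open {w :: (real ^ 'n) \<times> (real ^ 'n). norm (fst w - snd w) < L}"
      by (intro open_Collect_less continuous_intros)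
    then have "\<forall>\<^sub>F w in nhds (X j, Y j). w \<in> {w. norm (fst w - snd w) < L}"
      using rltL[of j] by (intro eventually_nhds_in_open) (auto simp: r_def)
    then show ?thesis
    proof eventually_elim
      case (elim w)
      then have "Z j w \<le> Z j (z j)" by (intro zmax) simp
      then show ?case by (simp add: Z_def zXY r_def)
    qed
  qed
  have XY: "X j \<noteq> Y j" for j using r0[of j] by (auto simp: r_def)
  have ev: "\<forall>\<^sub>F t in nhds s. (hyperbola a L has_real_derivative hyperbola_slope a L t) (at t)" for s
    by (intro always_eventually allI DERIV_hyperbola a)
  note tp = two_point_contact[OF XY r_def e_def ev DERIV_hyperbola(2)[OF a(1)] max]
  note ti = two_point_inequality[OF XY r_def e_def ev DERIV_hyperbola(2)[OF a(1)] max]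
  have e1: "norm (e j) = 1" for j using r0[of j] by (simp add: e_def r_def)
  have ee: "e j \<bullet> e j = 1" for j using e1[of j] by (simp add: norm_eq_1)
  define s where "s j = hyperbola_slope a L (r j)" for j
  have s0: "s j \<ge> 0" for j using rL[of j] a by (simp add: s_def hyperbola_slope_def)
  \<comment> \<open>The two gradients differ by the gradient of the penalty, which tends to zero although \<open>X j\<close> may
    be unbounded: the penalty itself is at most \<open>C\<close>.\<close>
  have err: "norm ((2 * \<epsilon> j) *\<^sub>R X j) \<le> 2 * sqrt (C * \<epsilon> j)" for j
  proof -
    have "\<epsilon> j * norm (X j) \<le> sqrt (C * \<epsilon> j)"
    proof (rule real_le_rsqrt)
      have "\<epsilon> j * (\<epsilon> j * (norm (X j))\<^sup>2) \<le> \<epsilon> j * C"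
        using XC[of j] \<epsilon>0[of j] by (intro mult_left_mono) auto
      then show "(\<epsilon> j * norm (X j))\<^sup>2 \<le> C * \<epsilon> j" by (simp add: power2_eq_square algebra_simps)
    qed
    then show ?thesis using \<epsilon>0[of j] by simp
  qed
  have "(\<lambda>j. 2 * sqrt (C * \<epsilon> j)) \<longlonglongrightarrow> 2 * sqrt (C * 0)"
    by (intro tendsto_intros \<epsilon>lim)
  then have lim0: "(\<lambda>j. 2 * sqrt (C * \<epsilon> j)) \<longlonglongrightarrow> 0" by simp
  have gX: "g (X j) = s j *\<^sub>R e j + (2 * \<epsilon> j) *\<^sub>R X j" for j using tp(2) by (simp add: s_def)
  have a1: "\<bar>norm (g (X j)) - s j\<bar> \<le> 2 * sqrt (C * \<epsilon> j)" for j
  proof -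
    have "norm (s j *\<^sub>R e j) = s j" using s0[of j] e1[of j] by simp
    then have "\<bar>norm (g (X j)) - s j\<bar> \<le> norm (g (X j) - s j *\<^sub>R e j)"
      by (metis norm_triangle_ineq3)
    also have "\<dots> = norm ((2 * \<epsilon> j) *\<^sub>R X j)" by (simp add: gX)
    finally show ?thesis using err[of j] by linarith
  qed
  have b1: "\<bar>g (X j) \<bullet> e j - s j\<bar> \<le> 2 * sqrt (C * \<epsilon> j)" for j
  proof -
    have "g (X j) \<bullet> e j - s j = ((2 * \<epsilon> j) *\<^sub>R X j) \<bullet> e j"
      by (simp add: gX inner_add_left ee)
    also have "\<bar>\<dots>\<bar> \<le> norm ((2 * \<epsilon> j) *\<^sub>R X j) * norm (e j)" by (rule Cauchy_Schwarz_ineq2)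
    finally show ?thesis using err[of j] e1[of j] by simp
  qed
  show False
  proof (rule concavity_excludes_limit[OF a \<delta>, where r = r and \<epsilon> = \<epsilon> and L = L
        and \<alpha> = "\<lambda>j. norm (g (X j))" and b = "\<lambda>j. g (X j) \<bullet> e j" and N = "real CARD('n)"])
    show "\<delta> \<le> r j \<and> r j \<le> L" for j using r\<delta> rL by blast
    show "\<epsilon> \<longlonglongrightarrow> 0" by (rule \<epsilon>lim)
    show "(\<lambda>j. norm (g (X j)) - hyperbola_slope a L (r j)) \<longlonglongrightarrow> 0"
      by (rule Lim_null_comparison[OF _ lim0]) (use a1 in \<open>simp add: s_def\<close>)
    show "(\<lambda>j. g (X j) \<bullet> e j - hyperbola_slope a L (r j)) \<longlonglongrightarrow> 0"
      by (rule Lim_null_comparison[OF _ lim0]) (use b1 in \<open>simp add: s_def\<close>)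
  next
    fix j
    have "sqrt (1 - (norm (g (X j)))\<^sup>2) \<ge> 0"
      using norm_gradient_squared_less_1[of "X j"] by simp
    then have "- B * sqrt (1 - (norm (g (X j)))\<^sup>2) \<le> - (u (X j) powr p) * sqrt (1 - (norm (g (X j)))\<^sup>2)"
      using B[of "X j"] by (intro mult_right_mono) auto
    from order_trans[OF this ti[of j]]
    show "- B * sqrt (1 - (norm (g (X j)))\<^sup>2) \<le> hyperbola_bend a L (r j) *
        ((stretch ((norm (g (X j)))\<^sup>2))\<^sup>2 * (norm (g (X j)))\<^sup>2 * (g (X j) \<bullet> e j)\<^sup>2
        + 2 * stretch ((norm (g (X j)))\<^sup>2) * (1 + 1 / sqrt (1 - (hyperbola_slope a L (r j))\<^sup>2)) * (g (X j) \<bullet> e j)\<^sup>2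
        + (1 + 1 / sqrt (1 - (hyperbola_slope a L (r j))\<^sup>2))\<^sup>2)
      + hyperbola_slope a L (r j) / r j * ((stretch ((norm (g (X j)))\<^sup>2))\<^sup>2 * (norm (g (X j)))\<^sup>2 * ((norm (g (X j)))\<^sup>2 - (g (X j) \<bullet> e j)\<^sup>2))
      + 2 * \<epsilon> j * (real CARD('n) + (norm (g (X j)))\<^sup>2 / (1 - (norm (g (X j)))\<^sup>2))" .
  qed
qed

text \<open>The comparison on short segments: the hyperbola lies below its tangent at the origin.\<close>
lemma gradient_bound:
  assumes a: "a > 0" "B * a < 4" and C: "C > 0" "\<And>x. u x \<le> C" and L: "L = C + a"
    and B: "\<And>x. u x powr p \<le> B"
  shows "norm (g y) \<le> L / sqrt (a\<^sup>2 + L\<^sup>2)"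
proof (cases "g y = 0")
  case True
  then show ?thesis using a C L by simp
next
  case False
  define e where "e = g y /\<^sub>R norm (g y)"
  define \<theta> where "\<theta> = L / sqrt (a\<^sup>2 + L\<^sup>2)"
  have e1: "norm e = 1" using False by (simp add: e_def)
  have ge: "g y \<bullet> e = norm (g y)" using False by (simp add: e_def dot_square_norm power2_eq_square)
  have d: "((\<lambda>t. u (y + t *\<^sub>R e) - \<theta> * t) has_real_derivative (g y \<bullet> e - \<theta>)) (at 0)"
    using gradient_along_line[of u y 0 e "g y"] gradient[of y]
    by (auto intro!: derivative_eq_intros)
  show ?thesis
  proof (rule ccontr)
    assume "\<not> ?thesis"
    then have "g y \<bullet> e - \<theta> > 0" by (simp add: ge \<theta>_def)
    from DERIV_pos_inc_right[OF d this] obtain \<delta> where \<delta>: "\<delta> > 0"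
      "\<And>h. 0 < h \<Longrightarrow> h < \<delta> \<Longrightarrow> u y < u (y + h *\<^sub>R e) - \<theta> * h" by auto
    define h where "h = min \<delta> L / 2"
    have h: "0 < h" "h < \<delta>" "h \<le> L" using \<delta>(1) a C L by (auto simp: h_def)
    have n: "norm (y + h *\<^sub>R e - y) = h" using h e1 by simp
    have "u (y + h *\<^sub>R e) - u y \<le> hyperbola a L (norm (y + h *\<^sub>R e - y))"
      using two_point_comparison[OF a C L B, of "y + h *\<^sub>R e" y] n h by simp
    also have "\<dots> \<le> \<theta> * h" unfolding n \<theta>_def using hyperbola_bounds(2)[OF a(1)] h by simp
    finally show False using \<delta>(2)[OF h(1,2)] by simp
  qed
qed

end

section \<open>Uniform bounds for entire solutions\<close>

lemma grad_eqI:
  assumes "GDERIV u x :> G"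
  shows "grad u x = G"
proof -
  have "partial i u x = G $ i" for i
    using gradient_along_line[of u x 0 "axis i 1" G] assms
    by (simp add: partial_def DERIV_imp_deriv inner_axis)
  then show ?thesis by (simp add: grad_def vec_eq_iff)
qed

lemma entire_solutionI:
  fixes u :: "real ^ 'n::finite \<Rightarrow> real"
  assumes "C2 u" "\<And>x. u x \<ge> 0" and lt: "\<And>x. norm (grad u x) < 1"
    and eq: "\<And>x. divergence (\<lambda>y. (1 / sqrt (1 - (norm (grad u y))\<^sup>2)) *\<^sub>R grad u y) x + u x powr p = 0"
  obtains H where "entire_solution u (grad u) H p"
proof -
  obtain g H where g: "\<And>x. GDERIV u x :> g x"
    and H: "\<And>x. (g has_derivative (\<lambda>h. H x *v h)) (at x)"
    using \<open>C2 u\<close> unfolding C2_def by blast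
  have gr: "grad u = g" using grad_eqI[OF g] by (simp add: fun_eq_iff)
  have "entire_solution u g H p"
  proof
    fix x
    show "GDERIV u x :> g x" "(g has_derivative (\<lambda>h. H x *v h)) (at x)" "0 \<le> u x"
      using g H assms by auto
    show n: "norm (g x) < 1" using lt by (simp add: gr)
    then have "sqrt (1 - (norm (g x))\<^sup>2) > 0" by (simp add: power_less_one_iff abs_square_less_1)
    then show "(\<Sum>i\<in>UNIV. (H x *v axis i 1) \<bullet> axis i 1)
      + ((H x *v g x) \<bullet> g x) / (1 - (norm (g x))\<^sup>2) = - (u x powr p) * sqrt (1 - (norm (g x))\<^sup>2)"
      using eq[of x] unfolding gr divergence_expanded[OF H n]
      by (simp add: add_eq_0_iff divide_eq_eq)
  qed
  then show ?thesis using that gr by simp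
qed

theorem theorem1p2:
  fixes p :: real
  assumes "CARD('n::finite) \<ge> 2" and "p \<ge> 1"
  shows "\<exists>C>1. \<forall>u :: real ^ 'n \<Rightarrow> real.
    C2 u \<and> (\<forall>x. u x \<ge> 0) \<and> (\<forall>x. norm (grad u x) < 1) \<and>
    (\<forall>x. divergence (\<lambda>y. (1 / sqrt (1 - (norm (grad u y))\<^sup>2)) *\<^sub>R grad u y) x + u x powr p = 0)
    \<longrightarrow>
    (SUP x. ereal (u x)) \<le> ereal C \<and>
    (SUP x. ereal (1 / sqrt (1 - (norm (grad u x))\<^sup>2))) \<le> ereal C \<and>
    (\<forall>x. norm (grad u x) \<le> sqrt (1 - 1 / C\<^sup>2)) \<and> sqrt (1 - 1 / C\<^sup>2) < 1"
proof -
  define h where "h = 2 + 2 * real CARD('n) * exp (8 * real CARD('n))"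
  define B where "B = h powr p"
  \<comment> \<open>Any \<open>a\<close> below \<open>4 / B\<close> would do.\<close>
  define a where "a = 2 / B"
  define L where "L = h + a"
  define v where "v = sqrt (a\<^sup>2 + L\<^sup>2) / a"
  define C where "C = h + v"
  have h2: "h \<ge> 2" by (simp add: h_def)
  have B: "B > 0" using h2 by (simp add: B_def)
  have a: "a > 0" "B * a < 4" using B by (auto simp: a_def)
  have aL: "a\<^sup>2 + L\<^sup>2 > 0" using a by (simp add: add_pos_nonneg)
  have v: "v > 0" "v\<^sup>2 = (a\<^sup>2 + L\<^sup>2) / a\<^sup>2" using a aL by (auto simp: v_def power_divide)
  have C1: "C > 1" using h2 v by (simp add: C_def)
  show ?thesis
  proof (intro exI[of _ C] conjI C1 allI impI)
    fix u :: "real ^ 'n \<Rightarrow> real"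
    assume asm: "C2 u \<and> (\<forall>x. u x \<ge> 0) \<and> (\<forall>x. norm (grad u x) < 1) \<and>
      (\<forall>x. divergence (\<lambda>y. (1 / sqrt (1 - (norm (grad u y))\<^sup>2)) *\<^sub>R grad u y) x + u x powr p = 0)"
    obtain H where "entire_solution u (grad u) H p"
      by (rule entire_solutionI[of u p]) (use asm in auto)
    then interpret entire_solution u "grad u" H p .
    have uh: "u x \<le> h" for x using height_bound[of x] assms(2) by (simp add: h_def)
    have uB: "u x powr p \<le> B" for x
      unfolding B_def using uh[of x] nonneg[of x] assms(2) by (intro powr_mono2) auto
    have "1 / v\<^sup>2 \<le> 1 - (norm (grad u x))\<^sup>2" for x
    proof -
      have "norm (grad u x) \<le> L / sqrt (a\<^sup>2 + L\<^sup>2)"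
        using h2 by (intro gradient_bound[OF a _ uh L_def uB]) auto
      then have "(norm (grad u x))\<^sup>2 \<le> (L / sqrt (a\<^sup>2 + L\<^sup>2))\<^sup>2" by (intro power_mono) auto
      also have "\<dots> = 1 - a\<^sup>2 / (a\<^sup>2 + L\<^sup>2)"
        using a(1) aL by (simp add: power_divide eq_diff_eq add_divide_distrib[symmetric] add.commute)
      finally show ?thesis by (simp add: v)
    qed
    moreover have "1 / C\<^sup>2 \<le> 1 / v\<^sup>2"
      using v(1) h2 by (intro divide_left_mono power_mono mult_pos_pos) (auto simp: C_def)
    ultimately have key: "1 / C\<^sup>2 \<le> 1 - (norm (grad u x))\<^sup>2" for x by (meson order_trans)
    show "(SUP x. ereal (u x)) \<le> ereal C"
    proof (rule SUP_least)
      show "ereal (u x) \<le> ereal C" for x using uh[of x] v(1) by (simp add: C_def)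
    qed
    show "(SUP x. ereal (1 / sqrt (1 - (norm (grad u x))\<^sup>2))) \<le> ereal C"
    proof (rule SUP_least)
      fix x
      have "1 / C \<le> sqrt (1 - (norm (grad u x))\<^sup>2)"
        using key[of x] by (intro real_le_rsqrt) (simp add: power_divide)
      moreover have "0 < 1 / C" using C1 by simp
      ultimately have "1 / sqrt (1 - (norm (grad u x))\<^sup>2) \<le> 1 / (1 / C)"
        using norm_gradient_squared_less_1[of x] C1 by (intro divide_left_mono mult_pos_pos) auto
      then show "ereal (1 / sqrt (1 - (norm (grad u x))\<^sup>2)) \<le> ereal C" by simp
    qed
    show "norm (grad u x) \<le> sqrt (1 - 1 / C\<^sup>2)" for x
      using key[of x] by (intro real_le_rsqrt) simp
    show "sqrt (1 - 1 / C\<^sup>2) < 1" using C1 by simp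
  qed
qed

end
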